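(* Let $\Lambda$ be the poset on $\{1,2,3\}$ with $1<3$, $2<3$ and $1,2$ incomparable. For all integers $0\le i\le j$, the interval $[1^i,3^j]$ in $\Lambda^*$ is homotopic to a wedge of $|\langle x^{j-i}\rangle T_{i+j}(x)|$ spheres, all of dimension $2j-i-2$.
   Context: $\Lambda^*$ is the set of finite words over $\Lambda$ with generalized subword order: $u\le w$ iff there are indices $i_1<\dots<i_k$, $k=|u|$, with $u(t)\le_\Lambda w(i_t)$ for all $t$. $a^m$ denotes the word consisting of $m$ copies of the letter $a$. $T_n(x)$ is the Chebyshev polynomial of the first kind ($T_0=1$, $T_1=x$, $T_n=2xT_{n-1}-T_{n-2}$), and $\langle x^m\rangle T_n(x)$ denotes the coefficient of $x^m$ in $T_n(x)$. An interval $[u,w]$ is homotopic to a space if the order complex of the open interval $(u,w)$ is. *)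

theory Defs
  imports "HOL-Analysis.Analysis" "HOL-Computational_Algebra.Polynomial"
begin

section \<open>Generalized subword order\<close>

text \<open>Words over a poset are lists. Positions are counted from 0, and the indices
  \<open>i\<^sub>1 < \<dots> < i\<^sub>k\<close> are the values of a strictly increasing function \<open>f\<close>.\<close>

definition subword_le :: "'a::order list \<Rightarrow> 'a list \<Rightarrow> bool"  (infix "\<preceq>\<^sub>w" 50) where
  "u \<preceq>\<^sub>w w \<longleftrightarrow>
    (\<exists>f. strict_mono_on {..<length u} f \<and> f ` {..<length u} \<subseteq> {..<length w}
       \<and> (\<forall>t<length u. u ! t \<le> w ! f t))"

definition open_word_interval :: "'a::order list \<Rightarrow> 'a list \<Rightarrow> 'a list set" where
  "open_word_interval u w = {v. u \<preceq>\<^sub>w v \<and> v \<preceq>\<^sub>w w \<and> v \<noteq> u \<and> v \<noteq> w}"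

datatype letter = L1 | L2 | L3

text \<open>The order on \<open>letter\<close> has exactly the strict relations \<open>L1 < L3\<close> and \<open>L2 < L3\<close>.\<close>

instantiation letter :: order
begin

definition less_eq_letter :: "letter \<Rightarrow> letter \<Rightarrow> bool" where
  "a \<le> b \<longleftrightarrow> a = b \<or> b = L3"

definition less_letter :: "letter \<Rightarrow> letter \<Rightarrow> bool" where
  "a < b \<longleftrightarrow> a \<noteq> b \<and> b = L3"

instance
  by standard (auto simp: less_eq_letter_def less_letter_def)

end


section \<open>Chebyshev polynomials of the first kind\<close>

fun chebyshev_T :: "nat \<Rightarrow> int poly" where
  "chebyshev_T 0 = 1"
| "chebyshev_T (Suc 0) = [:0, 1:]"
| "chebyshev_T (Suc (Suc n)) = 2 * [:0, 1:] * chebyshev_T (Suc n) - chebyshev_T n"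


section \<open>Order complexes and their geometric realizations\<close>

text \<open>Faces are the finite chains, the empty one included.\<close>

definition order_complex :: "('a \<Rightarrow> 'a \<Rightarrow> bool) \<Rightarrow> 'a set \<Rightarrow> 'a set set" where
  "order_complex R P = {F. finite F \<and> F \<subseteq> P \<and> (\<forall>x\<in>F. \<forall>y\<in>F. R x y \<or> R y x)}"

text \<open>Points are given by their barycentric coordinates; the support has to be a face.
  The topology is that of pointwise convergence. This is the usual topology when there are
  finitely many vertices, as in a word interval over a finite alphabet. The empty face
  contributes no point.\<close>

definition realization :: "'a set set \<Rightarrow> ('a \<Rightarrow> real) topology" where
  "realization K = subtopology (powertop_real UNIV)
     {x. (\<forall>v. 0 \<le> x v) \<and> {v. x v \<noteq> 0} \<in> K \<and> (\<Sum>v | x v \<noteq> 0. x v) = 1}"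


section \<open>Wedges of spheres\<close>

text \<open>The wedge of the spaces \<open>X i\<close> at the points \<open>p i\<close>: the disjoint union with all the
  \<open>p i\<close> identified to \<open>None\<close>, under the quotient topology. The wedge of no spaces is the
  one-point space.\<close>

definition wedge_proj :: "('i \<Rightarrow> 'a) \<Rightarrow> 'i \<Rightarrow> 'a \<Rightarrow> ('i \<times> 'a) option" where
  "wedge_proj p i x = (if x = p i then None else Some (i, x))"

definition wedge :: "'i set \<Rightarrow> ('i \<Rightarrow> 'a topology) \<Rightarrow> ('i \<Rightarrow> 'a) \<Rightarrow> ('i \<times> 'a) option topology" where
  "wedge I X p = topology (\<lambda>U.
     U \<subseteq> insert None (\<Union>i\<in>I. wedge_proj p i ` topspace (X i)) \<and>
     (\<forall>i\<in>I. openin (X i) {x \<in> topspace (X i). wedge_proj p i x \<in> U}))"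

lemma openin_wedge:
  "openin (wedge I X p) U \<longleftrightarrow>
     U \<subseteq> insert None (\<Union>i\<in>I. wedge_proj p i ` topspace (X i)) \<and>
     (\<forall>i\<in>I. openin (X i) {x \<in> topspace (X i). wedge_proj p i x \<in> U})"
proof -
  have 1: "{x \<in> topspace (X i). wedge_proj p i x \<in> S \<inter> T}
      = {x \<in> topspace (X i). wedge_proj p i x \<in> S} \<inter> {x \<in> topspace (X i). wedge_proj p i x \<in> T}"
    for S T i by auto
  have 2: "{x \<in> topspace (X i). wedge_proj p i x \<in> \<Union>\<K>}
      = (\<Union>K\<in>\<K>. {x \<in> topspace (X i). wedge_proj p i x \<in> K})" for \<K> i by auto
  have "istopology (\<lambda>U. U \<subseteq> insert None (\<Union>i\<in>I. wedge_proj p i ` topspace (X i)) \<and>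
     (\<forall>i\<in>I. openin (X i) {x \<in> topspace (X i). wedge_proj p i x \<in> U}))"
    unfolding istopology_def 1 2 by blast
  then show ?thesis
    by (simp add: wedge_def)
qed

lemma topspace_wedge:
  "topspace (wedge I X p) = insert None (\<Union>i\<in>I. wedge_proj p i ` topspace (X i))"
    (is "_ = ?T")
proof
  show "topspace (wedge I X p) \<subseteq> ?T"
    using openin_topspace[of "wedge I X p"] by (simp only: openin_wedge)
  have "{x \<in> topspace (X i). wedge_proj p i x \<in> ?T} = topspace (X i)" if "i \<in> I" for i
    using that by auto
  then have "openin (wedge I X p) ?T"
    by (simp add: openin_wedge)
  then show "?T \<subseteq> topspace (wedge I X p)"
    by (rule openin_subset)
qed

definition sphere_basepoint :: "nat \<Rightarrow> real" where
  "sphere_basepoint = (\<lambda>i. if i = 0 then 1 else 0)"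

lemma sphere_basepoint_in_nsphere: "sphere_basepoint \<in> topspace (nsphere n)"
  by (simp add: nsphere sphere_basepoint_def if_distrib[of "\<lambda>x. x ^ 2"] cong: if_cong)

text \<open>A sphere of negative dimension is the empty space. For dimension \<open>-1\<close> this is the unit
  sphere of the zero-dimensional Euclidean space. For dimension \<open>-2\<close> it is the usual convention
  for the open interval \<open>(u, u)\<close>, in agreement with \<open>\<mu>(u, u) = 1\<close>. The empty space has no
  basepoint, so the only wedge formed with it is that of a single copy.\<close>

definition homotopic_to_wedge_of_spheres :: "'a topology \<Rightarrow> nat \<Rightarrow> int \<Rightarrow> bool" where
  "homotopic_to_wedge_of_spheres X k d \<longleftrightarrow>
    (if 0 \<le> d
     then X homotopy_equivalent_space
            wedge {..<k} (\<lambda>_. nsphere (nat d)) (\<lambda>_. sphere_basepoint)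
     else k = 1 \<and> topspace X = {})"

definition interval_homotopic_to_wedge_of_spheres ::
    "'a::order list \<Rightarrow> 'a list \<Rightarrow> nat \<Rightarrow> int \<Rightarrow> bool" where
  "interval_homotopic_to_wedge_of_spheres u w k d \<longleftrightarrow>
    homotopic_to_wedge_of_spheres
      (realization (order_complex (\<preceq>\<^sub>w) (open_word_interval u w))) k d"

end

theory Submission
  imports Defs "HOL-Library.Sublist"
begin

text \<open>Call a complex good if it becomes collapsible after removing some of its top-dimensional cells. A good
  complex is homotopy equivalent to a wedge of one sphere for each removed cell. If deletion and link of a
  vertex \<open>x\<close> are good, with \<open>k\<close> and \<open>l\<close> removed cells, the whole complex is good with \<open>k + l\<close> removed cells,
  because the star of \<open>x\<close> collapses along with the link.

  In \<open>[1\<^sup>i, 3\<^sup>j]\<close> first remove the words \<open>1 3\<^sup>j\<^sup>-\<^sup>1\<close> and \<open>2 3\<^sup>j\<^sup>-\<^sup>1\<close>, with links \<open>(1\<^sup>i, c 3\<^sup>j\<^sup>-\<^sup>1)\<close> for \<open>c = 1, 2\<close>. The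
  other words \<open>1 v\<close> and \<open>2 v\<close> have a cone point \<open>3 v\<close> in their links, and what remains is a cone over
  \<open>3 1\<^sup>i\<^sup>-\<^sup>1\<close>. In \<open>(1\<^sup>i, c 3\<^sup>j\<^sup>-\<^sup>1)\<close> remove \<open>3\<^sup>j\<^sup>-\<^sup>1\<close>, with link \<open>(1\<^sup>i, 3\<^sup>j\<^sup>-\<^sup>1)\<close>; then every word \<open>v\<close> not starting
  with \<open>c\<close> has the cone point \<open>c v\<close>, and the words starting with \<open>c\<close> form a cone if \<open>c = 2\<close> or \<open>i = 0\<close>, and a copy of
  \<open>(1\<^sup>i\<^sup>-\<^sup>1, 3\<^sup>j\<^sup>-\<^sup>1)\<close> otherwise. Hence the number \<open>k(i, j)\<close> of removed cells satisfies
  \<open>k(i, j) = 2 k(i, j-1) + k(i-1, j-1)\<close>, the recurrence of the Chebyshev coefficients up to sign.\<close>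

subsection \<open>Collapses\<close>

text \<open>The empty face takes part in the collapse, so that a nonempty complex collapses to a vertex,
  and the vertex is then cancelled against the empty face.\<close>

inductive collapsible :: "'a set set \<Rightarrow> bool" where
  empty: "collapsible {}"
| step: "\<lbrakk>\<sigma> \<in> K; v \<notin> \<sigma>; insert v \<sigma> \<in> K; \<And>\<rho>. \<rho> \<in> K \<Longrightarrow> \<sigma> \<subseteq> \<rho> \<Longrightarrow> \<rho> = \<sigma> \<or> \<rho> = insert v \<sigma>;
    collapsible (K - {\<sigma>, insert v \<sigma>})\<rbrakk> \<Longrightarrow> collapsible K"

text \<open>The pairs of a collapse of \<open>L\<close>, with \<open>x\<close> added to both
  members, can be removed first: no member of \<open>K\<close> contains \<open>x\<close>, so each
  pair stays free. What then remains is \<open>K\<close>. Neither set has to be closed under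
  subfaces, so both may already have lost cells.\<close>

lemma collapsible_union_join:
  assumes "collapsible L" "collapsible K" "\<And>\<sigma>. \<sigma> \<in> K \<union> L \<Longrightarrow> x \<notin> \<sigma>"
  shows "collapsible (K \<union> insert x ` L)"
  using assms
proof (induction L rule: collapsible.induct)
  case empty
  then show ?case by simp
next
  case (step \<sigma> L v)
  have x: "\<And>\<rho>. \<rho> \<in> L \<Longrightarrow> x \<notin> \<rho>" "x \<notin> \<sigma>" "x \<notin> insert v \<sigma>"
    using step.prems step.hyps by blast+
  have eq: "K \<union> insert x ` L - {insert x \<sigma>, insert v (insert x \<sigma>)}
      = K \<union> insert x ` (L - {\<sigma>, insert v \<sigma>})"
  proof -
    have "insert x \<rho> = insert x \<tau> \<longleftrightarrow> \<rho> = \<tau>" if "x \<notin> \<rho>" "x \<notin> \<tau>" for \<rho> \<tau>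
      using that by (metis insert_ident)
    moreover have "insert x \<rho> \<notin> K" for \<rho>
      using step.prems(2) by blast
    moreover have "insert v (insert x \<sigma>) = insert x (insert v \<sigma>)"
      by blast
    ultimately show ?thesis
      using x by auto
  qed
  have "collapsible (K \<union> insert x ` (L - {\<sigma>, insert v \<sigma>}))"
    using step.IH step.prems by blast
  then have collapsible: "collapsible (K \<union> insert x ` L - {insert x \<sigma>, insert v (insert x \<sigma>)})"
    by (simp only: eq)
  show ?case
  proof (rule collapsible.step[OF _ _ _ _ collapsible])
    show "insert x \<sigma> \<in> K \<union> insert x ` L"
      using step.hyps(1) by blast
    show "v \<notin> insert x \<sigma>"
      using step.hyps(2) x(3) by blast
    show "insert v (insert x \<sigma>) \<in> K \<union> insert x ` L"
      using step.hyps(3) by (metis UnI2 imageI insert_commute)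
    fix \<rho> assume \<rho>: "\<rho> \<in> K \<union> insert x ` L" "insert x \<sigma> \<subseteq> \<rho>"
    then have "\<rho> \<notin> K"
      using step.prems(2)[of \<rho>] by auto
    then obtain \<tau> where \<tau>: "\<tau> \<in> L" "\<rho> = insert x \<tau>"
      using \<rho>(1) by blast
    then have "\<sigma> \<subseteq> \<tau>"
      using \<rho>(2) x(2) by blast
    with \<tau> step.hyps(4) show "\<rho> = insert x \<sigma> \<or> \<rho> = insert v (insert x \<sigma>)"
      by (metis insert_commute)
  qed
qed

text \<open>Faces are matched by adding or deleting \<open>y\<close>. A face \<sigma> maximal among
  those avoiding \<open>y\<close> is free, with \<open>insert y \<sigma>\<close> as its partner, and
  removing this pair leaves a cone.\<close>

lemma collapsible_cone:
  assumes "finite K" "\<And>\<sigma>. \<sigma> \<in> K \<Longrightarrow> insert y \<sigma> \<in> K \<and> \<sigma> - {y} \<in> K"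
  shows "collapsible K"
  using assms
proof (induction "card K" arbitrary: K rule: less_induct)
  case less
  show ?case
  proof (cases "K = {}")
    case True
    then show ?thesis by (simp add: collapsible.empty)
  next
    case False
    define N where "N = {\<sigma> \<in> K. y \<notin> \<sigma>}"
    have "finite N" "N \<noteq> {}"
      using less.prems False by (auto simp: N_def)
    then obtain \<sigma> where \<sigma>: "\<sigma> \<in> N" and max: "\<And>\<rho>. \<rho> \<in> N \<Longrightarrow> \<sigma> \<subseteq> \<rho> \<Longrightarrow> \<rho> = \<sigma>"
      using finite_has_maximal[of N] by metis
    have \<sigma>K: "\<sigma> \<in> K" "y \<notin> \<sigma>" "insert y \<sigma> \<in> K"
      using \<sigma> less.prems by (auto simp: N_def)
    have "collapsible (K - {\<sigma>, insert y \<sigma>})"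
    proof (rule less.hyps)
      show "card (K - {\<sigma>, insert y \<sigma>}) < card K"
        using \<sigma>K less.prems by (intro psubset_card_mono) auto
      show "insert y \<rho> \<in> K - {\<sigma>, insert y \<sigma>} \<and> \<rho> - {y} \<in> K - {\<sigma>, insert y \<sigma>}"
        if "\<rho> \<in> K - {\<sigma>, insert y \<sigma>}" for \<rho>
      proof -
        have "\<rho> - {y} \<noteq> \<sigma>"
          using that by blast
        moreover have "\<rho> - {y} = insert y \<rho> - {y}" "\<sigma> = insert y \<sigma> - {y}"
          using \<sigma>K by auto
        ultimately have "insert y \<rho> \<noteq> insert y \<sigma>" "\<rho> - {y} \<noteq> \<sigma>"
          by metis+
        then show ?thesis
          using that \<sigma>K less.prems by blast
      qed
    qed (use less.prems in auto)
    moreover have "\<rho> = \<sigma> \<or> \<rho> = insert y \<sigma>" if "\<rho> \<in> K" "\<sigma> \<subseteq> \<rho>" for \<rho>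
    proof -
      have "\<rho> - {y} \<in> N" "\<sigma> \<subseteq> \<rho> - {y}"
        using that \<sigma>K less.prems by (auto simp: N_def)
      then have "\<rho> - {y} = \<sigma>"
        by (rule max)
      then show ?thesis
        by blast
    qed
    ultimately show ?thesis
      using \<sigma>K by (metis collapsible.step)
  qed
qed

lemma inj_image: "inj f \<Longrightarrow> inj ((`) f)"
  by (rule injI) (simp add: inj_image_eq_iff)

lemma collapsible_image:
  assumes "collapsible K" "inj f"
  shows "collapsible ((`) f ` K)"
  using assms
proof (induction K rule: collapsible.induct)
  case empty
  then show ?case by (simp add: collapsible.empty)
next
  case (step \<sigma> K v)
  have "(`) f ` (K - {\<sigma>, insert v \<sigma>}) = (`) f ` K - {f ` \<sigma>, insert (f v) (f ` \<sigma>)}"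
    using image_set_diff[OF inj_image[OF step.prems], of K "{\<sigma>, insert v \<sigma>}"] by simp
  then have "collapsible ((`) f ` K - {f ` \<sigma>, insert (f v) (f ` \<sigma>)})"
    using step.IH step.prems by simp
  moreover have "\<rho> = f ` \<sigma> \<or> \<rho> = insert (f v) (f ` \<sigma>)" if \<rho>: "\<rho> \<in> (`) f ` K" "f ` \<sigma> \<subseteq> \<rho>" for \<rho>
  proof -
    obtain \<tau> where \<tau>: "\<tau> \<in> K" "\<rho> = f ` \<tau>"
      using \<rho> by blast
    then have "\<sigma> \<subseteq> \<tau>"
      using \<rho>(2) step.prems by (simp add: inj_image_subset_iff)
    then have "\<tau> = \<sigma> \<or> \<tau> = insert v \<sigma>"
      using \<tau>(1) step.hyps(4) by blast
    then show ?thesis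
      using \<tau>(2) by (metis image_insert)
  qed
  moreover have "insert (f v) (f ` \<sigma>) \<in> (`) f ` K"
    using step.hyps(3) by (metis image_eqI image_insert)
  moreover have "f ` \<sigma> \<in> (`) f ` K" "f v \<notin> f ` \<sigma>"
    using step.hyps(1,2) step.prems by (auto simp: inj_image_mem_iff)
  ultimately show ?case
    by (metis collapsible.step)
qed

text \<open>The parameter \<open>n\<close> counts vertices, so the removed cells have dimension
  \<open>n - 1\<close>; for \<open>n = 0\<close> the empty face can be removed. That no face is
  larger than these cells is established separately, by the rank bound on chains.\<close>

definition collapses_off_cells :: "nat \<Rightarrow> nat \<Rightarrow> 'a set set \<Rightarrow> bool" where
  "collapses_off_cells n k K \<longleftrightarrow>
    (\<exists>S\<subseteq>K. finite S \<and> card S = k \<and> (\<forall>\<sigma>\<in>S. card \<sigma> = n) \<and> collapsible (K - S))"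

lemma collapsible_imp_collapses_off_cells:
  "collapsible K \<Longrightarrow> collapses_off_cells n 0 K"
  by (force simp: collapses_off_cells_def)

lemma collapses_off_cells_image:
  assumes "collapses_off_cells n k K" "inj f"
  shows "collapses_off_cells n k ((`) f ` K)"
proof -
  obtain S where S: "S \<subseteq> K" "finite S" "card S = k" "\<forall>\<sigma>\<in>S. card \<sigma> = n" "collapsible (K - S)"
    using assms unfolding collapses_off_cells_def by blast
  have inj: "inj ((`) f)"
    using assms(2) by (rule inj_image)
  have "collapsible ((`) f ` K - (`) f ` S)"
    using collapsible_image[OF S(5) assms(2)] inj by (simp add: image_set_diff)
  moreover have "card ((`) f ` S) = k"
    using S inj by (metis card_image inj_on_subset subset_UNIV)
  moreover have "\<forall>\<sigma>\<in>(`) f ` S. card \<sigma> = n"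
    using S assms(2) by (auto simp: card_image inj_on_subset)
  ultimately show ?thesis
    unfolding collapses_off_cells_def using S by (intro exI[of _ "(`) f ` S"]) auto
qed

lemma complex_eq_deletion_union_star:
  "K = {\<sigma> \<in> K. x \<notin> \<sigma>} \<union> insert x ` {\<sigma>. x \<notin> \<sigma> \<and> insert x \<sigma> \<in> K}" (is "_ = ?D \<union> insert x ` ?L")
proof -
  have "\<sigma> \<in> insert x ` ?L" if "\<sigma> \<in> K" "x \<in> \<sigma>" for \<sigma>
    using that by (intro image_eqI[of _ _ "\<sigma> - {x}"]) (auto simp: insert_absorb)
  then show ?thesis
    by blast
qed

text \<open>Cells removed from the link reappear with \<open>x\<close> added, one vertex larger, and
  are disjoint from those removed from the deletion; hence the shift in size and the sum
  \<open>k + l\<close>. The rest collapses by \<open>collapsible_union_join\<close>.\<close>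

lemma collapses_off_cells_vertex:
  assumes D: "collapses_off_cells (Suc n) k {\<sigma> \<in> K. x \<notin> \<sigma>}" (is "collapses_off_cells _ _ ?D")
    and L: "collapses_off_cells n l {\<sigma>. x \<notin> \<sigma> \<and> insert x \<sigma> \<in> K}" (is "collapses_off_cells _ _ ?L")
    and fin: "\<And>\<sigma>. \<sigma> \<in> K \<Longrightarrow> finite \<sigma>"
  shows "collapses_off_cells (Suc n) (k + l) K"
proof -
  obtain S where S: "S \<subseteq> ?D" "finite S" "card S = k" "\<forall>\<sigma>\<in>S. card \<sigma> = Suc n"
    "collapsible (?D - S)"
    using D unfolding collapses_off_cells_def by blast
  obtain T where T: "T \<subseteq> ?L" "finite T" "card T = l" "\<forall>\<sigma>\<in>T. card \<sigma> = n"
    "collapsible (?L - T)"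
    using L unfolding collapses_off_cells_def by blast
  have inj: "inj_on (insert x) ?L"
    by (rule inj_onI) (auto dest: insert_ident)
  have finL: "finite \<sigma>" if "\<sigma> \<in> ?L" for \<sigma>
    using fin that by (metis (mono_tags, lifting) finite_insert mem_Collect_eq)
  have disj: "S \<inter> insert x ` T = {}"
    using S by blast
  have "K - (S \<union> insert x ` T) = (?D - S) \<union> (insert x ` ?L - insert x ` T)"
    using S(1) by (subst complex_eq_deletion_union_star[of K x]) blast
  also have "insert x ` ?L - insert x ` T = insert x ` (?L - T)"
    using inj T(1) by (simp add: inj_on_image_set_diff[of _ ?L])
  finally have "collapsible (K - (S \<union> insert x ` T))"
    using collapsible_union_join[OF T(5) S(5), of x] by auto
  moreover have "card (S \<union> insert x ` T) = k + l"
    using S T disj inj by (simp add: card_Un_disjoint card_image inj_on_subset)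
  moreover have "\<forall>\<sigma>\<in>S \<union> insert x ` T. card \<sigma> = Suc n"
    using S(4) T(1,4) finL by (auto simp: subset_iff)
  ultimately show ?thesis
    unfolding collapses_off_cells_def using S(1,2) T(1,2)
    by (intro exI[of _ "S \<union> insert x ` T"]) auto
qed

text \<open>The star of \<open>x\<close> collapses away without losing a cell, so deleting
  \<open>x\<close> changes neither the number nor the size of the removed cells.\<close>

lemma collapses_off_cells_vertex_collapsible_link:
  assumes D: "collapses_off_cells n k {\<sigma> \<in> K. x \<notin> \<sigma>}" (is "collapses_off_cells _ _ ?D")
    and L: "collapsible {\<sigma>. x \<notin> \<sigma> \<and> insert x \<sigma> \<in> K}" (is "collapsible ?L")
  shows "collapses_off_cells n k K"
proof -
  obtain S where S: "S \<subseteq> ?D" "finite S" "card S = k" "\<forall>\<sigma>\<in>S. card \<sigma> = n" "collapsible (?D - S)"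
    using D unfolding collapses_off_cells_def by blast
  have "K - S = (?D - S) \<union> insert x ` ?L"
    using S(1) by (subst complex_eq_deletion_union_star[of K x]) blast
  then have "collapsible (K - S)"
    using collapsible_union_join[OF L S(5), of x] by auto
  then show ?thesis
    unfolding collapses_off_cells_def using S by (intro exI[of _ S]) auto
qed

subsection \<open>Order complexes\<close>

lemma order_complex_deletion: "{\<sigma> \<in> order_complex R P. x \<notin> \<sigma>} = order_complex R (P - {x})"
  by (auto simp: order_complex_def)

lemma order_complex_link:
  assumes "x \<in> P" "R x x"
  shows "{\<sigma>. x \<notin> \<sigma> \<and> insert x \<sigma> \<in> order_complex R P}
    = order_complex R {y \<in> P. y \<noteq> x \<and> (R x y \<or> R y x)}"
  using assms by (auto simp: order_complex_def)

text \<open>The empty chain is the only face. Removing it as a cell of dimension -1 starts the count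
  in the recursion.\<close>

lemma collapses_off_cells_order_complex_empty: "collapses_off_cells 0 1 (order_complex R {})"
proof -
  have "order_complex R {} = {{}}"
    by (auto simp: order_complex_def)
  then show ?thesis
    unfolding collapses_off_cells_def by (intro exI[of _ "{{}}"]) (auto intro: collapsible.empty)
qed

lemma finite_order_complex: "finite P \<Longrightarrow> finite (order_complex R P)"
  by (rule finite_subset[of _ "Pow P"]) (auto simp: order_complex_def)

lemma collapsible_order_complex_cone:
  assumes "finite P" "y \<in> P" "\<And>z. z \<in> P \<Longrightarrow> R y z \<or> R z y"
  shows "collapsible (order_complex R P)"
proof (rule collapsible_cone[of _ y])
  show "finite (order_complex R P)"
    using assms(1) by (rule finite_order_complex)
qed (use assms in \<open>auto simp: order_complex_def\<close>)

lemma order_complex_image: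
  assumes "\<And>x y. x \<in> P \<Longrightarrow> y \<in> P \<Longrightarrow> R (f x) (f y) \<longleftrightarrow> R x y"
  shows "order_complex R (f ` P) = (`) f ` order_complex R P"
proof (intro equalityI subsetI)
  fix F assume F: "F \<in> order_complex R (f ` P)"
  then obtain G where G: "G \<subseteq> P" "finite G" "F = f ` G"
    by (metis (no_types, lifting) finite_subset_image mem_Collect_eq order_complex_def)
  with F assms have "G \<in> order_complex R P"
    by (auto simp: order_complex_def subset_iff)
  with G show "F \<in> (`) f ` order_complex R P"
    by blast
next
  fix F assume "F \<in> (`) f ` order_complex R P"
  then obtain G where "G \<in> order_complex R P" "F = f ` G"
    by blast
  with assms show "F \<in> order_complex R (f ` P)"
    by (auto simp: order_complex_def subset_iff Ball_def) blast+
qed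

text \<open>If the larger nonmembers of \<open>Q\<close> are removed first, \<open>f u\<close> is a cone point of the link of \<open>u\<close>.\<close>

lemma collapses_off_cells_closure:
  assumes "finite P" "Q \<subseteq> P"
    and refl: "\<And>x. R x x"
    and trans: "\<And>x y z. R x y \<Longrightarrow> R y z \<Longrightarrow> R x z"
    and antisym: "\<And>x y. R x y \<Longrightarrow> R y x \<Longrightarrow> x = y"
    and f: "\<And>u. u \<in> P - Q \<Longrightarrow> f u \<in> Q \<and> R u (f u)"
    and up: "\<And>u v. u \<in> P - Q \<Longrightarrow> v \<in> Q \<Longrightarrow> R u v \<Longrightarrow> R (f u) v"
    and Q: "collapses_off_cells n k (order_complex R Q)"
  shows "collapses_off_cells n k (order_complex R P)"
  using assms(1,2) f up
proof (induction "card (P - Q)" arbitrary: P)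
  case 0
  then have "P = Q"
    by (auto simp: finite_subset)
  then show ?case
    using Q by simp
next
  case (Suc m)
  define D where "D = P - Q"
  have "card D = Suc m"
    using Suc.hyps(2) by (simp add: D_def)
  then have D: "finite D" "D \<noteq> {}"
    using card.infinite by fastforce+
  interpret o: order R "\<lambda>x y. R x y \<and> x \<noteq> y"
    by unfold_locales (use refl trans antisym in blast)+
  obtain u where u: "u \<in> D" and max: "\<And>v. v \<in> D \<Longrightarrow> R u v \<Longrightarrow> v = u"
    using o.finite_has_maximal[OF D] by metis
  have "collapses_off_cells n k (order_complex R (P - {u}))"
  proof (rule Suc.hyps(1))
    have "P - {u} - Q = D - {u}"
      by (auto simp: D_def)
    then show "m = card (P - {u} - Q)"
      using Suc.hyps(2) u D by (simp add: D_def)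
  qed (use Suc.prems u in \<open>auto simp: D_def\<close>)
  moreover have "collapsible (order_complex R {y \<in> P. y \<noteq> u \<and> (R u y \<or> R y u)})"
  proof (rule collapsible_order_complex_cone[of _ "f u"])
    show "f u \<in> {y \<in> P. y \<noteq> u \<and> (R u y \<or> R y u)}"
      using Suc.prems(2) Suc.prems(3)[of u] u by (auto simp: D_def)
    show "R (f u) z \<or> R z (f u)" if "z \<in> {y \<in> P. y \<noteq> u \<and> (R u y \<or> R y u)}" for z
    proof (cases "R u z")
      case True
      then have "z \<in> Q"
        using max[of z] that unfolding D_def by blast
      then show ?thesis
        using Suc.prems(4) u True unfolding D_def by blast
    next
      case False
      then show ?thesis
        using that u Suc.prems(3) trans unfolding D_def by blast
    qed
  qed (use Suc.prems in auto)
  moreover have "u \<in> P"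
    using u by (simp add: D_def)
  ultimately show ?case
    using refl
    by (simp add: collapses_off_cells_vertex_collapsible_link[of n k _ u]
        order_complex_deletion order_complex_link)
qed

lemma collapses_off_cells_order_complex_vertex:
  assumes "x \<in> P" "R x x"
    and "collapses_off_cells (Suc n) k (order_complex R (P - {x}))"
    and "collapses_off_cells n l (order_complex R {y \<in> P. y \<noteq> x \<and> (R x y \<or> R y x)})"
  shows "collapses_off_cells (Suc n) (k + l) (order_complex R P)"
  by (rule collapses_off_cells_vertex[of _ _ _ x])
    (use assms in \<open>simp_all add: order_complex_deletion order_complex_link\<close>,
      auto simp: order_complex_def)

subsection \<open>Generalized subword order\<close>

text \<open>The inductive embedding relation allows comparison letter by letter. Given an index
  function, the two cases are whether or not the first letter of \<open>u\<close> is sent to the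
  first position of \<open>w\<close>; in both the remaining indices are positive and are lowered by
  one.\<close>

lemma subword_le_iff_list_emb: "u \<preceq>\<^sub>w w \<longleftrightarrow> list_emb (\<le>) u w"
proof
  assume "u \<preceq>\<^sub>w w"
  then obtain f where "strict_mono_on {..<length u} f" "f ` {..<length u} \<subseteq> {..<length w}"
    "\<forall>t<length u. u ! t \<le> w ! f t"
    unfolding subword_le_def by blast
  then show "list_emb (\<le>) u w"
  proof (induction w arbitrary: u f)
    case Nil
    then show ?case by auto
  next
    case (Cons b w)
    show ?case
    proof (cases u)
      case Nil
      then show ?thesis by simp
    next
      case u: (Cons a u')
      have mono: "f s < f t" if "s < t" "t < length u" for s t
        using Cons.prems(1) that by (auto simp: strict_mono_on_def)
      have bound: "f t < Suc (length w)" if "t < length u" for t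
        using Cons.prems(2) that by auto
      show ?thesis
      proof (cases "f 0 = 0")
        case True
        have pos: "f (Suc t) > 0" if "t < length u'" for t
          using mono[of 0 "Suc t"] that u by simp
        have "list_emb (\<le>) u' w"
        proof (rule Cons.IH[of _ "\<lambda>t. f (Suc t) - 1"])
          show "strict_mono_on {..<length u'} (\<lambda>t. f (Suc t) - 1)"
          proof (rule strict_mono_onI)
            fix r s assume "r \<in> {..<length u'}" "s \<in> {..<length u'}" "r < s"
            then show "f (Suc r) - 1 < f (Suc s) - 1"
              using mono[of "Suc r" "Suc s"] pos[of r] u by simp
          qed
          show "(\<lambda>t. f (Suc t) - 1) ` {..<length u'} \<subseteq> {..<length w}"
            using bound u pos by fastforce
          show "\<forall>t<length u'. u' ! t \<le> w ! (f (Suc t) - 1)"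
          proof (intro allI impI)
            fix t assume "t < length u'"
            then show "u' ! t \<le> w ! (f (Suc t) - 1)"
              using Cons.prems(3)[rule_format, of "Suc t"] pos[of t] u by (simp add: nth_Cons')
          qed
        qed
        moreover have "a \<le> b"
          using Cons.prems(3) u True by auto
        ultimately show ?thesis
          using u by auto
      next
        case False
        have pos: "f t > 0" if "t < length u" for t
          using mono[of 0 t] that False by (cases "t = 0") auto
        have "list_emb (\<le>) u w"
        proof (rule Cons.IH[of _ "\<lambda>t. f t - 1"])
          show "strict_mono_on {..<length u} (\<lambda>t. f t - 1)"
          proof (rule strict_mono_onI)
            fix r s assume "r \<in> {..<length u}" "s \<in> {..<length u}" "r < s"
            then show "f r - 1 < f s - 1"
              using mono[of r s] pos[of r] by simp
          qed
          show "(\<lambda>t. f t - 1) ` {..<length u} \<subseteq> {..<length w}"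
            using bound pos by fastforce
          show "\<forall>t<length u. u ! t \<le> w ! (f t - 1)"
          proof (intro allI impI)
            fix t assume "t < length u"
            then show "u ! t \<le> w ! (f t - 1)"
              using Cons.prems(3)[rule_format, of t] pos[of t] by (simp add: nth_Cons')
          qed
        qed
        then show ?thesis by auto
      qed
    qed
  qed
next
  assume "list_emb (\<le>) u w"
  then show "u \<preceq>\<^sub>w w"
  proof (induction rule: list_emb.induct)
    case (list_emb_Nil w)
    then show ?case by (simp add: subword_le_def)
  next
    case (list_emb_Cons u w b)
    then obtain f where "strict_mono_on {..<length u} f" "f ` {..<length u} \<subseteq> {..<length w}"
      "\<forall>t<length u. u ! t \<le> w ! f t"
      unfolding subword_le_def by blast
    then show ?case
      unfolding subword_le_def
      by (intro exI[of _ "\<lambda>t. Suc (f t)"]) (auto simp: strict_mono_on_def)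
  next
    case (list_emb_Cons2 a b u w)
    then obtain f where "strict_mono_on {..<length u} f" "f ` {..<length u} \<subseteq> {..<length w}"
      "\<forall>t<length u. u ! t \<le> w ! f t"
      unfolding subword_le_def by blast
    with list_emb_Cons2.hyps(1) show ?case
      unfolding subword_le_def
      by (intro exI[of _ "case_nat 0 (\<lambda>t. Suc (f t))"])
        (auto simp: strict_mono_on_def nth_Cons image_subset_iff split: nat.splits)
  qed
qed

lemma subword_le_refl: "u \<preceq>\<^sub>w u"
  by (simp add: subword_le_iff_list_emb list_emb_refl)

lemma subword_le_trans: "u \<preceq>\<^sub>w v \<Longrightarrow> v \<preceq>\<^sub>w w \<Longrightarrow> u \<preceq>\<^sub>w w"
  unfolding subword_le_iff_list_emb by (rule list_emb_trans) (auto intro: order_trans)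

lemma subword_le_length: "u \<preceq>\<^sub>w w \<Longrightarrow> length u \<le> length w"
  by (simp add: subword_le_iff_list_emb list_emb_length)

lemma Nil_subword_le [simp]: "[] \<preceq>\<^sub>w w"
  by (simp add: subword_le_iff_list_emb)

lemma not_Cons_subword_le_Nil [simp]: "\<not> a # u \<preceq>\<^sub>w []"
  by (simp add: subword_le_iff_list_emb)

text \<open>Greedy matching: any embedding of \<open>a # u\<close> into \<open>b # w\<close> embeds
  \<open>u\<close> into \<open>w\<close>, so nothing is lost by matching \<open>a\<close> with
  \<open>b\<close> when it fits. As a rewrite rule this settles the comparisons of explicit words
  below.\<close>

lemma Cons_subword_le_Cons [simp]:
  "a # u \<preceq>\<^sub>w b # w \<longleftrightarrow> (if a \<le> b then u \<preceq>\<^sub>w w else a # u \<preceq>\<^sub>w w)"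
  by (simp add: subword_le_iff_list_emb)

lemma subword_le_Cons: "u \<preceq>\<^sub>w w \<Longrightarrow> u \<preceq>\<^sub>w b # w"
  by (auto simp: subword_le_iff_list_emb)

text \<open>Skipping a letter of \<open>w\<close> would embed \<open>u\<close> in a shorter word, so
  with equal lengths every position is used.\<close>

lemma subword_le_same_length:
  assumes "u \<preceq>\<^sub>w w" "length u = length w"
  shows "list_all2 (\<le>) u w"
proof -
  have "list_emb (\<le>) u w"
    using assms(1) by (simp add: subword_le_iff_list_emb)
  then show ?thesis
    using assms(2)
  proof (induction rule: list_emb.induct)
    case (list_emb_Cons u w b)
    then show ?case
      using list_emb_length by fastforce
  qed auto
qed

lemma subword_le_antisym:
  assumes "u \<preceq>\<^sub>w v" "v \<preceq>\<^sub>w u"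
  shows "u = v"
proof -
  have "length u = length v"
    using assms subword_le_length by (metis le_antisym)
  then have "list_all2 (\<le>) u v" "list_all2 (\<le>) v u"
    using assms by (auto intro: subword_le_same_length)
  then show ?thesis
    by (intro list_all2_antisym[of "(\<le>)" "(\<le>)"]) auto
qed

subsection \<open>The poset with 1 and 2 below 3\<close>

text \<open>\<open>L1\<close> and \<open>L3\<close> are exactly the letters above \<open>L1\<close>,
  so the counted positions are those that can receive a letter of \<open>1^i\<close>.\<close>

definition support_length :: "letter list \<Rightarrow> nat" where
  "support_length v = length (filter ((\<noteq>) L2) v)"

lemma support_length_simps [simp]:
  "support_length [] = 0"
  "support_length (a # v) = (if a = L2 then 0 else 1) + support_length v"
  "support_length (replicate n L1) = n"
  "support_length (replicate n L3) = n"
  by (auto simp: support_length_def)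

lemma replicate_L1_subword_le: "replicate i L1 \<preceq>\<^sub>w v \<longleftrightarrow> i \<le> support_length v"
proof (induction v arbitrary: i)
  case Nil
  then show ?case by (cases i) auto
next
  case (Cons a v)
  show ?case
  proof (cases i)
    case (Suc k)
    then show ?thesis
      using Cons.IH[of k] Cons.IH[of i] by (cases a) (auto simp: less_eq_letter_def)
  qed simp
qed

lemma subword_le_replicate_L3: "v \<preceq>\<^sub>w replicate j L3 \<longleftrightarrow> length v \<le> j"
proof (induction j arbitrary: v)
  case 0
  then show ?case by (cases v) auto
next
  case (Suc j)
  then show ?case by (cases v) (auto simp: less_eq_letter_def)
qed

lemma subword_le_Cons_replicate_L3:
  assumes "c \<noteq> L3"
  shows "v \<preceq>\<^sub>w c # replicate m L3 \<longleftrightarrow> length v \<le> m \<or> length v = Suc m \<and> hd v = c"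
  using assms by (cases v) (auto simp: less_eq_letter_def subword_le_replicate_L3)

lemma replicate_L3_neq_replicate_L1: "m > 0 \<Longrightarrow> replicate m L3 \<noteq> replicate i L1"
  by (cases m; cases i) auto

lemma UNIV_letter: "UNIV = {L1, L2, L3}"
  using letter.exhaust by auto

lemma finite_open_word_interval: "finite (open_word_interval u (w :: letter list))"
proof (rule finite_subset)
  show "open_word_interval u w \<subseteq> {v. set v \<subseteq> {L1, L2, L3} \<and> length v \<le> length w}"
    using UNIV_letter by (auto simp: open_word_interval_def dest: subword_le_length)
qed (rule finite_lists_length_le, simp)

abbreviation word_complex :: "letter list set \<Rightarrow> letter list set set" where
  "word_complex \<equiv> order_complex (\<preceq>\<^sub>w)"

lemma word_complex_closure:
  assumes "finite P" "Q \<subseteq> P"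
    and "\<And>u. u \<in> P - Q \<Longrightarrow> f u \<in> Q \<and> u \<preceq>\<^sub>w f u"
    and "\<And>u v. u \<in> P - Q \<Longrightarrow> v \<in> Q \<Longrightarrow> u \<preceq>\<^sub>w v \<Longrightarrow> f u \<preceq>\<^sub>w v"
    and "collapses_off_cells n k (word_complex Q)"
  shows "collapses_off_cells n k (word_complex P)"
  by (rule collapses_off_cells_closure[where f = f, OF assms(1,2) subword_le_refl
        subword_le_trans subword_le_antisym assms(3-5)])

subsection \<open>Collapsing the intervals\<close>

definition lower_interval :: "nat \<Rightarrow> nat \<Rightarrow> letter list set" where
  "lower_interval i j = open_word_interval (replicate i L1) (replicate j L3)"

lemma in_lower_interval:
  "v \<in> lower_interval i j \<longleftrightarrow>
    i \<le> support_length v \<and> length v \<le> j \<and> v \<noteq> replicate i L1 \<and> v \<noteq> replicate j L3"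
  by (simp add: lower_interval_def open_word_interval_def replicate_L1_subword_le
      subword_le_replicate_L3)

definition coatom_interval :: "letter \<Rightarrow> nat \<Rightarrow> nat \<Rightarrow> letter list set" where
  "coatom_interval c i m = open_word_interval (replicate i L1) (c # replicate m L3)"

lemma in_coatom_interval:
  assumes "c \<noteq> L3"
  shows "v \<in> coatom_interval c i m \<longleftrightarrow> i \<le> support_length v \<and>
    (length v \<le> m \<or> length v = Suc m \<and> hd v = c) \<and> v \<noteq> replicate i L1 \<and> v \<noteq> c # replicate m L3"
  using assms
  by (simp add: coatom_interval_def open_word_interval_def replicate_L1_subword_le
      subword_le_Cons_replicate_L3)

text \<open>The closure map takes \<open>v\<close> to \<open>c v\<close>. A word \<open>v\<close>
  not starting with \<open>c\<close> that embeds in \<open>c v'\<close> already embeds in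
  \<open>v'\<close>, as \<open>c\<close> is minimal, so \<open>c v\<close> is the least word
  starting with \<open>c\<close> above \<open>v\<close>. The word \<open>3^m\<close> is excluded
  because its image would be the top \<open>c 3^m\<close>.\<close>

lemma coatom_interval_collapse_to_prefix:
  assumes c: "c \<noteq> L3" and m: "m > 0"
    and E: "collapses_off_cells n k (word_complex {v \<in> coatom_interval c i m. v \<noteq> [] \<and> hd v = c})"
  shows "collapses_off_cells n k (word_complex (coatom_interval c i m - {replicate m L3}))"
proof (rule word_complex_closure[where f = "(#) c"])
  let ?E = "{v \<in> coatom_interval c i m. v \<noteq> [] \<and> hd v = c}"
  let ?P = "coatom_interval c i m - {replicate m L3}"
  show "finite ?P"
    by (simp add: coatom_interval_def finite_open_word_interval)
  show "?E \<subseteq> ?P"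
    using c m by (cases m) auto
  show "c # u \<in> ?E \<and> u \<preceq>\<^sub>w c # u" if "u \<in> ?P - ?E" for u
  proof -
    \<comment> \<open>The image is not the bottom: otherwise \<open>u\<close> would be
      \<open>1^(i-1)\<close>, whose support is too short for the interval.\<close>
    have "c # u \<noteq> replicate i L1"
    proof
      assume eq: "c # u = replicate i L1"
      then obtain l where "i = Suc l" "u = replicate l L1"
        by (cases i) auto
      with that c show False
        by (simp add: in_coatom_interval)
    qed
    moreover have "length u \<le> m"
      using that c by (auto simp: in_coatom_interval)
    ultimately show ?thesis
      using that c by (auto simp: in_coatom_interval subword_le_Cons subword_le_refl)
  qed
  show "c # u \<preceq>\<^sub>w v" if u: "u \<in> ?P - ?E" and v: "v \<in> ?E" and "u \<preceq>\<^sub>w v" for u v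
  proof -
    obtain v' where v': "v = c # v'"
      using v by (cases v) auto
    show ?thesis
      using u c v' \<open>u \<preceq>\<^sub>w v\<close> by (cases u) (auto simp: less_eq_letter_def)
  qed
qed (rule E)

text \<open>Nothing lies strictly between \<open>3^m\<close> and \<open>c 3^m\<close>, so the link
  of \<open>3^m\<close> consists of the words below it, that is, of a lower interval.\<close>

lemma coatom_interval_remove_replicate_L3:
  assumes c: "c \<noteq> L3" and im: "i \<le> m" and m: "m > 0"
    and E: "collapses_off_cells (Suc n) k
      (word_complex {v \<in> coatom_interval c i m. v \<noteq> [] \<and> hd v = c})"
    and P: "collapses_off_cells n l (word_complex (lower_interval i m))"
  shows "collapses_off_cells (Suc n) (k + l) (word_complex (coatom_interval c i m))"
proof (rule collapses_off_cells_order_complex_vertex[of "replicate m L3"])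
  show "replicate m L3 \<in> coatom_interval c i m"
    using im m c replicate_L3_neq_replicate_L1[of m i]
    by (auto simp: in_coatom_interval dest: arg_cong[of _ _ length])
  show "collapses_off_cells (Suc n) k
      (word_complex (coatom_interval c i m - {replicate m L3}))"
    using c m E by (rule coatom_interval_collapse_to_prefix)
  have "{y \<in> coatom_interval c i m. y \<noteq> replicate m L3 \<and>
      (replicate m L3 \<preceq>\<^sub>w y \<or> y \<preceq>\<^sub>w replicate m L3)} = lower_interval i m" (is "?L = _")
  proof (intro equalityI subsetI)
    fix y assume y: "y \<in> ?L"
    \<comment> \<open>A word of full length \<open>Suc m\<close> in the link would be
      \<open>c y'\<close> with \<open>y'\<close> above \<open>3^m\<close>, hence the excluded top
      \<open>c 3^m\<close>.\<close>
    have "length y \<le> m"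
    proof (rule ccontr)
      assume "\<not> length y \<le> m"
      then have len: "length y = Suc m" "hd y = c" and le: "replicate m L3 \<preceq>\<^sub>w y"
        using y c by (auto simp: in_coatom_interval subword_le_replicate_L3)
      then obtain y' where y': "y = c # y'" "length y' = m"
        by (cases y) auto
      then have "replicate m L3 \<preceq>\<^sub>w y'"
        using le c m by (cases m) (auto simp: less_eq_letter_def)
      then have "y' = replicate m L3"
        using y' by (intro subword_le_antisym) (auto simp: subword_le_replicate_L3)
      then show False
        using y y' c by (simp add: in_coatom_interval)
    qed
    then show "y \<in> lower_interval i m"
      using y c by (simp add: in_lower_interval in_coatom_interval)
  next
    fix y assume "y \<in> lower_interval i m"
    then show "y \<in> ?L"
      using c by (auto simp: in_lower_interval in_coatom_interval subword_le_replicate_L3)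
  qed
  then show "collapses_off_cells n l (word_complex {y \<in> coatom_interval c i m.
      y \<noteq> replicate m L3 \<and> (replicate m L3 \<preceq>\<^sub>w y \<or> y \<preceq>\<^sub>w replicate m L3)})"
    using P by simp
qed (rule subword_le_refl)

text \<open>The apex \<open>c 1^i\<close> is the least word of this set: a leading 2 adds nothing to
  the support, so \<open>i\<close> letters above 1 must follow it; for \<open>c = L1\<close> and
  \<open>i = 0\<close> the apex is a one-letter word. The condition \<open>m > 0\<close> keeps the
  apex apart from the top \<open>c 3^m\<close>.\<close>

lemma coatom_interval_prefix_cone:
  assumes c: "c = L2 \<or> c = L1 \<and> i = 0" and im: "i \<le> m" and m: "m > 0"
  shows "collapsible (word_complex {v \<in> coatom_interval c i m. v \<noteq> [] \<and> hd v = c})"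
proof (rule collapsible_order_complex_cone[of _ "c # replicate i L1"])
  show "finite {v \<in> coatom_interval c i m. v \<noteq> [] \<and> hd v = c}"
    by (simp add: coatom_interval_def finite_open_word_interval)
  have "c # replicate i L1 \<noteq> replicate i L1"
    by (metis length_Cons length_replicate n_not_Suc_n)
  moreover have "replicate i L1 \<noteq> replicate m L3"
    using replicate_L3_neq_replicate_L1[OF m] by metis
  ultimately show "c # replicate i L1 \<in> {v \<in> coatom_interval c i m. v \<noteq> [] \<and> hd v = c}"
    using c im by (auto simp: in_coatom_interval)
  show "c # replicate i L1 \<preceq>\<^sub>w z \<or> z \<preceq>\<^sub>w c # replicate i L1"
    if "z \<in> {v \<in> coatom_interval c i m. v \<noteq> [] \<and> hd v = c}" for z
    using that c
    by (cases z) (auto simp: in_coatom_interval less_eq_letter_def replicate_L1_subword_le)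
qed

text \<open>A common first letter cancels in every comparison, which turns the bounds
  \<open>1^(i+1)\<close> and \<open>1 3^m\<close> into \<open>1^i\<close> and
  \<open>3^m\<close>.\<close>

lemma coatom_interval_L1_prefix:
  assumes "m > 0"
  shows "{v \<in> coatom_interval L1 (Suc i) m. v \<noteq> [] \<and> hd v = L1} = (#) L1 ` lower_interval i m"
    (is "?E = _")
proof (intro equalityI subsetI)
  fix v assume v: "v \<in> ?E"
  then obtain v' where "v = L1 # v'"
    by (cases v) auto
  with v show "v \<in> (#) L1 ` lower_interval i m"
    by (auto simp: in_coatom_interval in_lower_interval)
qed (auto simp: in_coatom_interval in_lower_interval le_Suc_eq)

text \<open>The closure map raises the first letter to 3; the two excluded words are the ones it
  would send to the top \<open>3^(m+1)\<close>. No cell is lost, since the words starting with 3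
  form a cone over their least element.\<close>

lemma lower_interval_collapse_to_prefix:
  assumes m: "m > 0" and i: "i \<le> Suc m"
  shows "collapses_off_cells n 0
    (word_complex (lower_interval i (Suc m) - {L1 # replicate m L3, L2 # replicate m L3}))"
proof (rule word_complex_closure[where f = "\<lambda>u. L3 # tl u"])
  let ?P = "lower_interval i (Suc m) - {L1 # replicate m L3, L2 # replicate m L3}"
  let ?Q = "{v \<in> lower_interval i (Suc m). v \<noteq> [] \<and> hd v = L3}"
  show "finite ?P"
    by (simp add: lower_interval_def finite_open_word_interval)
  show "?Q \<subseteq> ?P"
    by auto
  have nonempty: "v \<noteq> []" if "v \<in> lower_interval i (Suc m)" for v
    using that by (auto simp: in_lower_interval)
  show "L3 # tl u \<in> ?Q \<and> u \<preceq>\<^sub>w L3 # tl u" if u: "u \<in> ?P - ?Q" for u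
  proof -
    obtain a u' where "u = a # u'"
      using u nonempty by (cases u) auto
    with u show ?thesis
      by (cases a; cases i)
        (auto simp: in_lower_interval less_eq_letter_def subword_le_refl)
  qed
  show "L3 # tl u \<preceq>\<^sub>w v" if "u \<in> ?P - ?Q" "v \<in> ?Q" "u \<preceq>\<^sub>w v" for u v
    using that by (cases u; cases v) (auto simp: less_eq_letter_def)
  have "collapsible (word_complex ?Q)"
  \<comment> \<open>The leading 3 accounts for one of the \<open>i\<close> letters above 1; for
    \<open>i = 0\<close> the truncated \<open>i - 1\<close> gives the one-letter word 3.\<close>
  proof (rule collapsible_order_complex_cone[of _ "L3 # replicate (i - 1) L1"])
    show "finite ?Q"
      by (simp add: lower_interval_def finite_open_word_interval)
    have "replicate (i - 1) L1 \<noteq> replicate m L3"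
      using replicate_L3_neq_replicate_L1[OF m] by metis
    then show "L3 # replicate (i - 1) L1 \<in> ?Q"
      using i by (cases i) (auto simp: in_lower_interval)
    show "L3 # replicate (i - 1) L1 \<preceq>\<^sub>w z \<or> z \<preceq>\<^sub>w L3 # replicate (i - 1) L1" if "z \<in> ?Q" for z
      using that by (cases z) (auto simp: in_lower_interval replicate_L1_subword_le)
  qed
  then show "collapses_off_cells n 0 (word_complex ?Q)"
    by (rule collapsible_imp_collapses_off_cells)
qed

text \<open>\<open>c 3^m\<close> is covered by \<open>3^(m+1)\<close>, so its link is everything
  below it. The words of \<open>X\<close> have been deleted before; full length and a different
  first letter keep them from lying below \<open>c 3^m\<close>.\<close>

lemma coatom_interval_eq_link:
  assumes c: "c \<noteq> L3" and X: "\<And>v. v \<in> X \<Longrightarrow> length v = Suc m \<and> hd v \<noteq> c"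
  shows "{y \<in> lower_interval i (Suc m) - X. y \<noteq> c # replicate m L3 \<and>
      (c # replicate m L3 \<preceq>\<^sub>w y \<or> y \<preceq>\<^sub>w c # replicate m L3)} = coatom_interval c i m" (is "?L = _")
proof (intro equalityI subsetI)
  fix y assume y: "y \<in> ?L"
  have "\<not> c # replicate m L3 \<preceq>\<^sub>w y"
  proof
    assume le: "c # replicate m L3 \<preceq>\<^sub>w y"
    then have "length y = Suc m"
      using y subword_le_length[OF le] by (simp add: in_lower_interval)
    then obtain b y' where b: "y = b # y'" "length y' = m"
      by (cases y) auto
    then have "\<not> c # replicate m L3 \<preceq>\<^sub>w y'"
      using subword_le_length by fastforce
    with le b have "c \<le> b" "replicate m L3 \<preceq>\<^sub>w y'"
      by (auto split: if_splits)
    then have "y' = replicate m L3"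
      using b by (intro subword_le_antisym) (auto simp: subword_le_replicate_L3)
    with \<open>c \<le> b\<close> b y show False
      by (auto simp: less_eq_letter_def in_lower_interval)
  qed
  then show "y \<in> coatom_interval c i m"
    using y c by (auto simp: in_lower_interval in_coatom_interval subword_le_Cons_replicate_L3)
next
  fix y assume y: "y \<in> coatom_interval c i m"
  have "y \<notin> X"
    using y c X[of y] by (auto simp: in_coatom_interval)
  moreover have "y \<noteq> replicate (Suc m) L3"
    using y c by (auto simp: in_coatom_interval)
  ultimately show "y \<in> ?L"
    using y c by (auto simp: in_coatom_interval in_lower_interval subword_le_Cons_replicate_L3)
qed

text \<open>The row \<open>i = 0\<close> lacks the second term of the recurrence. At
  \<open>j = 1\<close> it takes the value 1 and not 2: the interval then consists of the
  incomparable words 1 and 2, and removing one cell suffices.\<close>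

fun cell_count :: "nat \<Rightarrow> nat \<Rightarrow> nat" where
  "cell_count 0 0 = 1"
| "cell_count 0 (Suc 0) = 1"
| "cell_count 0 (Suc (Suc j)) = 2 * cell_count 0 (Suc j)"
| "cell_count (Suc i) 0 = 0"
| "cell_count (Suc i) (Suc j) = 2 * cell_count (Suc i) j + cell_count i j"

lemma cell_count_eq_0: "j < i \<Longrightarrow> cell_count i j = 0"
  by (induction i j rule: cell_count.induct) auto

text \<open>With rank 1 for the letters 1 and 2 and rank 2 for 3, there are
  \<open>2 * m + 1 - i\<close> ranks strictly between \<open>1^i\<close> and \<open>3^(m+1)\<close>.
  The removed cells are thus chains meeting each of them.\<close>

theorem lower_interval_collapses_off_cells:
  assumes "i \<le> Suc m"
  shows "collapses_off_cells (2 * m + 1 - i) (cell_count i (Suc m)) (word_complex (lower_interval i (Suc m)))"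
  using assms
proof (induction m arbitrary: i)
  case 0
  show ?case
  proof (cases i)
    case 0
    \<comment> \<open>Two incomparable points: deleting one leaves a point, and its empty link
      contributes the single cell.\<close>
    have "v \<in> lower_interval 0 (Suc 0) \<longleftrightarrow> v = [L1] \<or> v = [L2]" for v
    proof (cases v)
      case (Cons a w)
      then show ?thesis by (cases a) (auto simp: in_lower_interval)
    qed (simp add: in_lower_interval)
    then have P: "lower_interval 0 (Suc 0) = {[L1], [L2]}"
      by blast
    have "collapses_off_cells (Suc 0) (0 + 1) (word_complex (lower_interval 0 (Suc 0)))"
    proof (rule collapses_off_cells_order_complex_vertex[of "[L1]"])
      show "[L1] \<in> lower_interval 0 (Suc 0)"
        by (simp add: P)
      have "collapsible (word_complex {[L2]})"
        by (rule collapsible_order_complex_cone[of _ "[L2]"]) (auto simp: less_eq_letter_def)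
      moreover have "lower_interval 0 (Suc 0) - {[L1]} = {[L2]}"
        by (auto simp: P)
      ultimately show "collapses_off_cells (Suc 0) 0 (word_complex (lower_interval 0 (Suc 0) - {[L1]}))"
        by (simp add: collapsible_imp_collapses_off_cells)
      have "{y \<in> lower_interval 0 (Suc 0). y \<noteq> [L1] \<and> ([L1] \<preceq>\<^sub>w y \<or> y \<preceq>\<^sub>w [L1])} = {}"
        by (auto simp: P less_eq_letter_def)
      then show "collapses_off_cells 0 1
          (word_complex {y \<in> lower_interval 0 (Suc 0). y \<noteq> [L1] \<and> ([L1] \<preceq>\<^sub>w y \<or> y \<preceq>\<^sub>w [L1])})"
        by (simp only: collapses_off_cells_order_complex_empty)
    qed (rule subword_le_refl)
    then show ?thesis
      using 0 by simp
  next
    case (Suc k)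
    then have "i = Suc 0"
      using 0 by simp
    have "v \<notin> lower_interval (Suc 0) (Suc 0)" for v
    proof (cases v)
      case (Cons a w)
      then show ?thesis by (cases a) (auto simp: in_lower_interval)
    qed (simp add: in_lower_interval)
    then have "lower_interval (Suc 0) (Suc 0) = {}"
      by blast
    then show ?thesis
      using \<open>i = Suc 0\<close> by (simp add: collapses_off_cells_order_complex_empty[simplified])
  qed
next
  case (Suc m')
  define m where "m = Suc m'"
  have m: "m > 0" by (simp add: m_def)
  have i: "i \<le> Suc m" using Suc.prems by (simp add: m_def)
  have IH: "collapses_off_cells (2 * m - 1 - i) (cell_count i m) (word_complex (lower_interval i m))"
    if "i \<le> m" for i
    using Suc.IH[of i] that by (simp add: m_def)
  \<comment> \<open>The first summand comes from the words starting with 1, the second from the link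
    of \<open>3^m\<close>. For the words starting with 2 the first summand disappears, as they form
    a cone; this leaves \<open>?k2\<close>.\<close>
  let ?k1 = "(if i = 0 then 0 else cell_count (i - 1) m) + cell_count i m"
  let ?k2 = "cell_count i m"
  have Q1: "collapses_off_cells (2 * m - i) ?k1 (word_complex (coatom_interval L1 i m))"
  proof -
    have E: "collapses_off_cells (2 * m - i) (if i = 0 then 0 else cell_count (i - 1) m)
      (word_complex {v \<in> coatom_interval L1 i m. v \<noteq> [] \<and> hd v = L1})"
    proof (cases i)
      case 0
      then show ?thesis
        using coatom_interval_prefix_cone[of L1 i m] m
        by (simp add: collapsible_imp_collapses_off_cells)
    next
      case (Suc k)
      have "word_complex ((#) L1 ` lower_interval k m)
          = (`) ((#) L1) ` word_complex (lower_interval k m)"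
        by (rule order_complex_image) simp
      \<comment> \<open>The size of the cells is already right: \<open>i = Suc k\<close> makes
        \<open>2 * m - 1 - k\<close> equal to \<open>2 * m - i\<close>.\<close>
      moreover have "collapses_off_cells (2 * m - 1 - k) (cell_count k m)
          ((`) ((#) L1) ` word_complex (lower_interval k m))"
        using IH[of k] i Suc by (intro collapses_off_cells_image) auto
      ultimately show ?thesis
        using Suc m by (simp add: coatom_interval_L1_prefix)
    qed
    show ?thesis
    proof (cases "i \<le> m")
      case True
      have "2 * m - i = Suc (2 * m - 1 - i)"
        using True m by simp
      then show ?thesis
        using coatom_interval_remove_replicate_L3[of L1 i m "2 * m - 1 - i", OF _ True m _ IH[OF True]]
          E by simp
    next
      \<comment> \<open>Here \<open>i = Suc m\<close>, so \<open>3^m\<close> is not above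
        \<open>1^i\<close>; there is no vertex to remove, and \<open>cell_count i m\<close> is 0
        accordingly.\<close>
      case False
      then have "replicate m L3 \<notin> coatom_interval L1 i m"
        by (simp add: in_coatom_interval)
      then have "coatom_interval L1 i m = coatom_interval L1 i m - {replicate m L3}"
        by simp
      then show ?thesis
        using coatom_interval_collapse_to_prefix[OF _ m E] False by (simp add: cell_count_eq_0)
    qed
  qed
  \<comment> \<open>The vertex \<open>2 3^m\<close> is treated inside the deletion of
    \<open>1 3^m\<close>. Once both are gone no cell is removed, so only the link of
    \<open>2 3^m\<close> contributes here.\<close>
  have "collapses_off_cells (Suc (2 * m - i)) ?k2
     (word_complex (lower_interval i (Suc m) - {L1 # replicate m L3}))"
  proof (cases "i \<le> m")
    case True
    have "2 * m - i = Suc (2 * m - 1 - i)"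
      using True m by simp
    then have Q2: "collapses_off_cells (2 * m - i) ?k2 (word_complex (coatom_interval L2 i m))"
      using coatom_interval_remove_replicate_L3[of L2 i m "2 * m - 1 - i", OF _ True m _ IH[OF True]]
        coatom_interval_prefix_cone[OF _ True m, of L2]
      by (fastforce dest: collapsible_imp_collapses_off_cells)
    have "collapses_off_cells (Suc (2 * m - i)) (0 + ?k2)
      (word_complex (lower_interval i (Suc m) - {L1 # replicate m L3}))"
    proof (rule collapses_off_cells_order_complex_vertex[of "L2 # replicate m L3"])
      have "L2 # replicate m L3 \<noteq> replicate i L1"
        by (cases i) auto
      then show "L2 # replicate m L3 \<in> lower_interval i (Suc m) - {L1 # replicate m L3}"
        using True by (simp add: in_lower_interval)
      have "lower_interval i (Suc m) - {L1 # replicate m L3} - {L2 # replicate m L3}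
        = lower_interval i (Suc m) - {L1 # replicate m L3, L2 # replicate m L3}"
        by blast
      then show "collapses_off_cells (Suc (2 * m - i)) 0 (word_complex
          (lower_interval i (Suc m) - {L1 # replicate m L3} - {L2 # replicate m L3}))"
        using lower_interval_collapse_to_prefix[OF m i] by simp
    qed (use Q2 m coatom_interval_eq_link[of L2 "{L1 # replicate m L3}" m]
        in \<open>auto simp: subword_le_refl\<close>)
    then show ?thesis by simp
  next
    case False
    then have "L2 # replicate m L3 \<notin> lower_interval i (Suc m)"
      by (simp add: in_lower_interval)
    then have "lower_interval i (Suc m) - {L1 # replicate m L3}
      = lower_interval i (Suc m) - {L1 # replicate m L3, L2 # replicate m L3}"
      by blast
    then show ?thesis
      using lower_interval_collapse_to_prefix[OF m i] False by (simp add: cell_count_eq_0)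
  qed
  then have "collapses_off_cells (Suc (2 * m - i)) (?k2 + ?k1) (word_complex (lower_interval i (Suc m)))"
  proof (rule collapses_off_cells_order_complex_vertex[of "L1 # replicate m L3", rotated 2])
    have "L1 # replicate m L3 \<noteq> replicate i L1"
      using replicate_L3_neq_replicate_L1[OF m] by (cases i) auto
    then show "L1 # replicate m L3 \<in> lower_interval i (Suc m)"
      using i by (simp add: in_lower_interval)
  qed (use Q1 m coatom_interval_eq_link[of L1 "{}" m] in \<open>auto simp: subword_le_refl\<close>)
  moreover have "?k2 + ?k1 = cell_count i (Suc m)"
    by (cases i) (simp_all add: m_def)
  moreover have "Suc (2 * m - i) = 2 * Suc m' + 1 - i"
    using i m by (simp add: m_def)
  ultimately show ?case
    by (simp add: m_def)
qed

subsection \<open>Chebyshev coefficients\<close>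

lemma coeff_chebyshev_T_Suc_Suc:
  "coeff (chebyshev_T (Suc (Suc n))) (Suc m) = 2 * coeff (chebyshev_T (Suc n)) m - coeff (chebyshev_T n) (Suc m)"
  "coeff (chebyshev_T (Suc (Suc n))) 0 = - coeff (chebyshev_T n) 0"
  by (simp_all add: numeral_poly)

lemma coeff_chebyshev_T_eq_0: "n < m \<Longrightarrow> coeff (chebyshev_T n) m = 0"
proof (induction n arbitrary: m rule: chebyshev_T.induct)
  case 2
  then show ?case
    by (simp add: coeff_pCons split: nat.splits)
next
  case (3 n)
  then obtain l where "m = Suc l" "Suc n < l"
    by (cases m) auto
  then show ?case
    using 3 by (simp add: coeff_chebyshev_T_Suc_Suc del: chebyshev_T.simps)
qed simp

text \<open>At \<open>(i, j)\<close> the Chebyshev recurrence refers to the coefficient at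
  \<open>(i, j-1)\<close> with factor 2 and to that at \<open>(i-1, j-1)\<close> with a minus sign,
  which the sign \<open>(-1)^i\<close> absorbs. In the row \<open>i = 0\<close> the subtracted
  coefficient lies beyond the degree.\<close>

lemma coeff_chebyshev_T_eq_cell_count:
  "i \<le> j \<Longrightarrow> coeff (chebyshev_T (i + j)) (j - i) = (- 1) ^ i * int (cell_count i j)"
proof (induction i j rule: cell_count.induct)
  case (3 j)
  then show ?case
    by (simp add: coeff_chebyshev_T_Suc_Suc coeff_chebyshev_T_eq_0 del: chebyshev_T.simps)
next
  case (5 i j)
  show ?case
  proof (cases "i = j")
    \<comment> \<open>For constant coefficients the term with factor 2 is absent, which matches
      \<open>cell_count (Suc j) j = 0\<close>.\<close>
    case True
    then show ?thesis
      using 5 by (simp add: coeff_chebyshev_T_Suc_Suc cell_count_eq_0 del: chebyshev_T.simps)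
  next
    case False
    then obtain l where l: "j = Suc (i + l)"
      using 5(3) less_iff_Suc_add by (metis Suc_le_mono le_neq_implies_less)
    then show ?thesis
      using 5 by (simp add: coeff_chebyshev_T_Suc_Suc algebra_simps del: chebyshev_T.simps)
  qed
qed auto

subsection \<open>The rank function\<close>

definition word_rank :: "letter list \<Rightarrow> nat" where
  "word_rank v = (\<Sum>a\<leftarrow>v. if a = L3 then 2 else 1)"

lemma word_rank_mono: "u \<preceq>\<^sub>w v \<Longrightarrow> word_rank u \<le> word_rank v \<and> (word_rank u = word_rank v \<longrightarrow> u = v)"
  unfolding subword_le_iff_list_emb
proof (induction rule: list_emb.induct)
  case (list_emb_Nil v)
  then show ?case by (cases v) (auto simp: word_rank_def)
next
  case (list_emb_Cons2 a b u v)
  then show ?case by (auto simp: word_rank_def less_eq_letter_def)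
qed (auto simp: word_rank_def)

lemma word_rank_replicate [simp]:
  "word_rank (replicate n L1) = n" "word_rank (replicate n L3) = 2 * n"
  by (simp_all add: word_rank_def sum_list_replicate)

text \<open>On a chain the rank is injective, with values strictly between the ranks of the bounds.
  For \<open>[1^i, 3^j]\<close> this bound equals the size of the removed cells, which are therefore
  top-dimensional.\<close>

lemma card_word_chain:
  assumes "F \<in> word_complex (open_word_interval u w)" "u \<preceq>\<^sub>w w"
  shows "card F \<le> word_rank w - word_rank u - 1"
proof -
  have "inj_on word_rank F"
  proof (rule inj_onI)
    fix x y assume "x \<in> F" "y \<in> F" "word_rank x = word_rank y"
    moreover from this have "x \<preceq>\<^sub>w y \<or> y \<preceq>\<^sub>w x"
      using assms(1) by (auto simp: order_complex_def)
    ultimately show "x = y"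
      using word_rank_mono by metis
  qed
  moreover have "word_rank ` F \<subseteq> {word_rank u<..<word_rank w}"
  proof
    fix n assume "n \<in> word_rank ` F"
    then obtain v where v: "n = word_rank v" "u \<preceq>\<^sub>w v" "v \<preceq>\<^sub>w w" "v \<noteq> u" "v \<noteq> w"
      using assms(1) by (auto simp: order_complex_def open_word_interval_def)
    then show "n \<in> {word_rank u<..<word_rank w}"
      using word_rank_mono[of u v] word_rank_mono[of v w] by force
  qed
  ultimately have "card F \<le> card {word_rank u<..<word_rank w}"
    using card_inj_on_le by blast
  then show ?thesis
    by simp
qed

subsection \<open>Quotient maps and wedges\<close>

text \<open>Since \<open>h\<close> ends constant on \<open>C\<close>, its end map descends along
  \<open>f\<close> to a homotopy inverse; since \<open>h\<close> keeps \<open>C\<close> inside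
  \<open>C\<close>, the composite of \<open>f\<close> after \<open>h\<close> descends to a homotopy
  on \<open>Z\<close>. Compactness and the Hausdorff property make \<open>f\<close> and its product
  with the interval quotient maps, so both descended maps are continuous.\<close>

lemma homotopy_equivalent_space_quotient:
  assumes X: "compact_space X" and Z: "Hausdorff_space Z"
    and f: "continuous_map X Z f" "f ` topspace X = topspace Z"
    and C: "C \<subseteq> topspace X" "\<And>x y. x \<in> C \<Longrightarrow> y \<in> C \<Longrightarrow> f x = f y"
    and inj: "\<And>x y. x \<in> topspace X \<Longrightarrow> y \<in> topspace X \<Longrightarrow> f x = f y \<Longrightarrow> x = y \<or> x \<in> C \<and> y \<in> C"
    and h: "continuous_map (prod_topology (top_of_set {0..1::real}) X) X h"
      "\<And>x. x \<in> topspace X \<Longrightarrow> h (0, x) = x"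
      "\<And>t x. t \<in> {0..1} \<Longrightarrow> x \<in> C \<Longrightarrow> h (t, x) \<in> C"
      "\<And>x. x \<in> C \<Longrightarrow> h (1, x) = a"
  shows "X homotopy_equivalent_space Z"
proof -
  let ?I = "top_of_set {0..1::real}"
  let ?F = "\<lambda>p. (fst p, f (snd p))"
  have q: "quotient_map X Z f"
    using f X Z by (intro continuous_imp_quotient_map)
  have "continuous_map X X (h \<circ> (\<lambda>x. (1, x)))"
    by (rule continuous_map_compose[OF _ h(1)]) (auto simp: continuous_map_pairwise o_def)
  then have h1: "continuous_map X X (\<lambda>x. h (1, x))"
    by (simp add: o_def)
  obtain g where g: "continuous_map Z X g" "\<And>x. x \<in> topspace X \<Longrightarrow> g (f x) = h (1, x)"
    using quotient_map_lift_exists[OF q h1] inj h(4) by metis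
  have F: "continuous_map (prod_topology ?I X) (prod_topology ?I Z) ?F"
    using continuous_map_compose[OF continuous_map_snd f(1), of ?I]
    by (auto simp: continuous_map_pairwise o_def continuous_map_fst)
  have "?F ` topspace (prod_topology ?I X) = topspace (prod_topology ?I Z)"
    unfolding f(2)[symmetric] topspace_prod_topology by force
  then have qF: "quotient_map (prod_topology ?I X) (prod_topology ?I Z) ?F"
    using F X Z
    by (intro continuous_imp_quotient_map)
      (auto simp: compact_space_prod_topology Hausdorff_space_prod_topology
        compact_space_subtopology Hausdorff_space_subtopology)
  have fh: "continuous_map (prod_topology ?I X) Z (\<lambda>p. f (h p))"
    using continuous_map_compose[OF h(1) f(1)] by (simp add: o_def)
  have "f (h p) = f (h p')" if "p \<in> topspace (prod_topology ?I X)"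
    "p' \<in> topspace (prod_topology ?I X)" "?F p = ?F p'" for p p'
  proof -
    have *: "fst p' = fst p" "f (snd p) = f (snd p')" "snd p \<in> topspace X" "snd p' \<in> topspace X"
      "fst p \<in> {0..1}"
      using that by auto
    then have "snd p = snd p' \<or> snd p \<in> C \<and> snd p' \<in> C"
      by (intro inj)
    then have "h (fst p, snd p) = h (fst p, snd p') \<or>
        h (fst p, snd p) \<in> C \<and> h (fst p, snd p') \<in> C"
      by (metis h(3)[OF *(5)])
    then show ?thesis
      using C(2) *(1) by (metis prod.collapse)
  qed
  then obtain k where k: "continuous_map (prod_topology ?I Z) Z k"
    "\<And>p. p \<in> topspace (prod_topology ?I X) \<Longrightarrow> k (?F p) = f (h p)"
    using quotient_map_lift_exists[OF qF fh] by metis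
  have "homotopic_with (\<lambda>x. True) X X id (g \<circ> f)"
    using h(1,2) g(2) by (subst homotopic_with) (auto intro!: exI[of _ h])
  moreover have "homotopic_with (\<lambda>x. True) Z Z id (f \<circ> g)"
  proof (subst homotopic_with; (intro exI[of _ k] conjI ballI)?)
    fix z assume "z \<in> topspace Z"
    then obtain x where x: "x \<in> topspace X" "z = f x"
      using f(2) by blast
    show "k (0, z) = id z"
      using k(2)[of "(0, x)"] x h(2) by simp
    show "k (1, z) = (f \<circ> g) z"
      using k(2)[of "(1, x)"] x g(2) by simp
  qed (use k(1) in auto)
  ultimately show ?thesis
    unfolding homotopy_equivalent_space_def using f(1) g(1) by (metis homotopic_with_symD)
qed

lemma continuous_map_wedge_proj:
  assumes "i \<in> I"
  shows "continuous_map (X i) (wedge I X p) (wedge_proj p i)"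
  using assms by (auto simp: continuous_map_def topspace_wedge openin_wedge)

lemma Hausdorff_space_if_separated:
  assumes "\<And>x y. x \<in> topspace X \<Longrightarrow> y \<in> topspace X \<Longrightarrow> x \<noteq> y \<Longrightarrow>
    \<exists>Y f. Hausdorff_space (Y :: 'b topology) \<and> continuous_map X Y f \<and> f x \<noteq> f y"
  shows "Hausdorff_space X"
  unfolding Hausdorff_space_def
proof (intro allI impI)
  fix x y assume xy: "x \<in> topspace X \<and> y \<in> topspace X \<and> x \<noteq> y"
  then obtain Y :: "'b topology" and f where f: "Hausdorff_space Y" "continuous_map X Y f" "f x \<noteq> f y"
    using assms by blast
  moreover have "f x \<in> topspace Y" "f y \<in> topspace Y"
    using f(2) xy by (auto simp: continuous_map_def)
  ultimately obtain U V where "openin Y U" "openin Y V" "f x \<in> U" "f y \<in> V" "disjnt U V"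
    unfolding Hausdorff_space_def by blast
  then show "\<exists>U V. openin X U \<and> openin X V \<and> x \<in> U \<and> y \<in> V \<and> disjnt U V"
    using xy openin_continuous_map_preimage[OF f(2)]
    by (intro exI[of _ "{z \<in> topspace X. f z \<in> U}"] exI[of _ "{z \<in> topspace X. f z \<in> V}"])
      (auto simp: disjnt_def)
qed

text \<open>Each summand is a retract of the wedge, all other summands being sent to its basepoint,
  and these retractions together separate points.\<close>

lemma Hausdorff_space_wedge:
  fixes X :: "'i \<Rightarrow> 'a topology"
  assumes "\<And>i. i \<in> I \<Longrightarrow> Hausdorff_space (X i)" "\<And>i. i \<in> I \<Longrightarrow> p i \<in> topspace (X i)"
  shows "Hausdorff_space (wedge I X p)"
proof (rule Hausdorff_space_if_separated)
  define r where "r i z = (case z of None \<Rightarrow> p i | Some (j, x) \<Rightarrow> if j = i then x else p i)" for i z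
  have r: "continuous_map (wedge I X p) (X i) (r i)" if "i \<in> I" for i
    unfolding continuous_map_def
  proof (intro conjI allI impI)
    have r_proj: "r i (wedge_proj p j x) = (if j = i then x else p i)" for j x
      by (auto simp: r_def wedge_proj_def)
    show "r i \<in> topspace (wedge I X p) \<rightarrow> topspace (X i)"
      using assms(2)[OF that] r_proj by (auto simp: topspace_wedge r_def[of i None])
    fix U assume U: "openin (X i) U"
    have "openin (X j) {x \<in> topspace (X j). wedge_proj p j x \<in> {z \<in> topspace (wedge I X p). r i z \<in> U}}"
      if "j \<in> I" for j
    proof -
      have "{x \<in> topspace (X j). wedge_proj p j x \<in> {z \<in> topspace (wedge I X p). r i z \<in> U}}
        = {x \<in> topspace (X j). (if j = i then x else p i) \<in> U}"
        using that by (auto simp: r_proj topspace_wedge)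
      also have "openin (X j) \<dots>"
      proof (cases "j = i")
        case True
        have "{x \<in> topspace (X i). x \<in> U} = U"
          using openin_subset[OF U] by blast
        with True U show ?thesis by simp
      next
        case False
        then show ?thesis by (cases "p i \<in> U") auto
      qed
      finally show ?thesis .
    qed
    then show "openin (wedge I X p) {z \<in> topspace (wedge I X p). r i z \<in> U}"
      unfolding openin_wedge[of I X p "{z \<in> topspace (wedge I X p). r i z \<in> U}"]
      by (auto simp: topspace_wedge)
  qed
  fix y z assume yz: "y \<in> topspace (wedge I X p)" "z \<in> topspace (wedge I X p)" "y \<noteq> z"
  have "\<exists>i\<in>I. r i y \<noteq> r i z" if "y = Some (i, x)" "i \<in> I" "x \<noteq> p i" "y \<noteq> z" for y z i x
    using that by (intro bexI[of _ i]) (auto simp: r_def split: option.splits prod.splits)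
  moreover have "y = None \<or> (\<exists>i x. y = Some (i, x) \<and> i \<in> I \<and> x \<noteq> p i)"
    if "y \<in> topspace (wedge I X p)" for y
    using that by (auto simp: topspace_wedge wedge_proj_def)
  ultimately have "\<exists>i\<in>I. r i y \<noteq> r i z"
    using yz by metis
  then show "\<exists>Y f. Hausdorff_space (Y :: 'a topology) \<and> continuous_map (wedge I X p) Y f \<and> f y \<noteq> f z"
    using r assms(1) by blast
qed

subsection \<open>Geometric realizations\<close>

definition simplicial_complex :: "'a set set \<Rightarrow> bool" where
  "simplicial_complex K \<longleftrightarrow> finite K \<and> (\<forall>\<sigma>\<in>K. finite \<sigma> \<and> (\<forall>\<rho>. \<rho> \<subseteq> \<sigma> \<longrightarrow> \<rho> \<in> K))"

lemma simplicial_complex_order_complex: "finite P \<Longrightarrow> simplicial_complex (order_complex R P)"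
  unfolding simplicial_complex_def
proof (intro conjI ballI allI impI)
  show "finite (order_complex R P)" if "finite P"
    using that by (rule finite_order_complex)
qed (auto simp: order_complex_def subset_iff intro: finite_subset)

text \<open>For the empty face the sum is 0, so the set is empty, in agreement with
  \<open>realization\<close>.\<close>

definition closed_simplex :: "'a set \<Rightarrow> ('a \<Rightarrow> real) set" where
  "closed_simplex \<sigma> = {x. (\<forall>v. 0 \<le> x v) \<and> (\<forall>v. v \<notin> \<sigma> \<longrightarrow> x v = 0) \<and> sum x \<sigma> = 1}"

lemma topspace_realization:
  "topspace (realization K) = {x. (\<forall>v. 0 \<le> x v) \<and> {v. x v \<noteq> 0} \<in> K \<and> (\<Sum>v | x v \<noteq> 0. x v) = 1}"
  by (simp add: realization_def)

lemma topspace_realization_eq_Union: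
  assumes "simplicial_complex K"
  shows "topspace (realization K) = (\<Union>\<sigma>\<in>K. closed_simplex \<sigma>)"
proof (intro equalityI subsetI)
  fix x assume "x \<in> topspace (realization K)"
  then have "{v. x v \<noteq> 0} \<in> K" "x \<in> closed_simplex {v. x v \<noteq> 0}"
    by (auto simp: topspace_realization closed_simplex_def)
  then show "x \<in> (\<Union>\<sigma>\<in>K. closed_simplex \<sigma>)"
    by blast
next
  fix x assume "x \<in> (\<Union>\<sigma>\<in>K. closed_simplex \<sigma>)"
  then obtain \<sigma> where \<sigma>: "\<sigma> \<in> K" "x \<in> closed_simplex \<sigma>"
    by blast
  then have supp: "{v. x v \<noteq> 0} \<subseteq> \<sigma>"
    by (auto simp: closed_simplex_def)
  have "finite \<sigma>" "{v. x v \<noteq> 0} \<in> K"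
    using assms \<sigma>(1) supp by (auto simp: simplicial_complex_def)
  moreover have "(\<Sum>v | x v \<noteq> 0. x v) = sum x \<sigma>"
    using supp \<open>finite \<sigma>\<close> by (intro sum.mono_neutral_left) auto
  ultimately show "x \<in> topspace (realization K)"
    using \<sigma>(2) by (simp add: topspace_realization closed_simplex_def)
qed

lemma closed_simplex_subset_realization:
  "simplicial_complex K \<Longrightarrow> \<sigma> \<in> K \<Longrightarrow> closed_simplex \<sigma> \<subseteq> topspace (realization K)"
  by (auto simp: topspace_realization_eq_Union)

lemma realization_supportD:
  assumes "x \<in> topspace (realization K)"
  shows "{v. x v \<noteq> 0} \<in> K" "x \<in> closed_simplex {v. x v \<noteq> 0}"
  using assms by (auto simp: topspace_realization closed_simplex_def)

lemma closed_simplex_face: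
  assumes "x \<in> closed_simplex \<sigma>" "finite \<sigma>" "{v. x v \<noteq> 0} \<subseteq> \<tau>" "\<tau> \<subseteq> \<sigma>"
  shows "x \<in> closed_simplex \<tau>"
proof -
  have "sum x \<tau> = sum x \<sigma>"
    using assms by (intro sum.mono_neutral_left) auto
  with assms show ?thesis
    by (auto simp: closed_simplex_def)
qed

section \<open>Continuity and compactness in barycentric coordinates\<close>

lemma continuous_map_realization_coordinate:
  "continuous_map (realization K) euclideanreal (\<lambda>x. x v)"
  unfolding realization_def
  by (intro continuous_map_from_subtopology continuous_map_product_coordinates) simp

lemma continuous_map_into_realization:
  "continuous_map X (realization K) f \<longleftrightarrow>
    (\<forall>v. continuous_map X euclideanreal (\<lambda>x. f x v)) \<and> f \<in> topspace X \<rightarrow> topspace (realization K)"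
  unfolding topspace_realization
  by (simp add: realization_def continuous_map_in_subtopology continuous_map_componentwise_UNIV)

lemma compactin_closed_simplex:
  assumes "finite \<sigma>"
  shows "compactin (powertop_real UNIV) (closed_simplex \<sigma>)"
proof -
  let ?B = "\<Pi>\<^sub>E v\<in>UNIV. if v \<in> \<sigma> then {0..1::real} else {0}"
  have "continuous_map (powertop_real UNIV) euclideanreal (\<lambda>x. sum x \<sigma>)"
    using assms by (intro continuous_map_sum continuous_map_product_coordinates) auto
  then have "closedin (powertop_real UNIV) {x \<in> topspace (powertop_real UNIV). sum x \<sigma> \<in> {1}}"
    by (rule closedin_continuous_map_preimage) auto
  moreover have "compactin (powertop_real UNIV) ?B"
    by (subst compactin_PiE) auto
  ultimately have "compactin (powertop_real UNIV)
      ({x \<in> topspace (powertop_real UNIV). sum x \<sigma> \<in> {1}} \<inter> ?B)"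
    by (rule closed_Int_compactin)
  also have "{x \<in> topspace (powertop_real UNIV). sum x \<sigma> \<in> {1}} \<inter> ?B = closed_simplex \<sigma>"
  proof (intro equalityI subsetI)
    fix x assume x: "x \<in> closed_simplex \<sigma>"
    have "x v \<le> 1" if "v \<in> \<sigma>" for v
      using member_le_sum[of v \<sigma> x] that x assms by (simp add: closed_simplex_def)
    with x show "x \<in> {x \<in> topspace (powertop_real UNIV). sum x \<sigma> \<in> {1}} \<inter> ?B"
      by (auto simp: closed_simplex_def)
  next
    fix x assume "x \<in> {x \<in> topspace (powertop_real UNIV). sum x \<sigma> \<in> {1}} \<inter> ?B"
    then have "sum x \<sigma> = 1" and xB: "x \<in> ?B"
      by auto
    moreover have B: "x v \<in> (if v \<in> \<sigma> then {0..1} else {0})" for v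
      using PiE_mem[OF xB, of v] by simp
    moreover have "0 \<le> x v" "v \<notin> \<sigma> \<Longrightarrow> x v = 0" for v
      using B[of v] by (auto split: if_splits)
    ultimately show "x \<in> closed_simplex \<sigma>"
      by (simp add: closed_simplex_def)
  qed
  finally show ?thesis .
qed

lemma Hausdorff_space_realization: "Hausdorff_space (realization K)"
  unfolding realization_def
  by (intro Hausdorff_space_subtopology) (auto simp: Hausdorff_space_product_topology)

lemma compactin_realization:
  assumes "simplicial_complex K"
  shows "compactin (powertop_real UNIV) (topspace (realization K))"
  unfolding topspace_realization_eq_Union[OF assms]
  using assms by (intro compactin_Union) (auto simp: simplicial_complex_def compactin_closed_simplex)

lemma realization_eq_subtopology: "realization K = subtopology (powertop_real UNIV) (topspace (realization K))"
  by (simp add: topspace_realization) (simp add: realization_def)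

lemma compact_space_realization:
  "simplicial_complex K \<Longrightarrow> compact_space (realization K)"
  by (metis compactin_realization compact_space_subtopology realization_eq_subtopology)

lemma closedin_realization:
  assumes "compactin (powertop_real UNIV) C" "C \<subseteq> topspace (realization K)"
  shows "closedin (realization K) C"
proof -
  have "compactin (realization K) C"
    using assms by (subst realization_eq_subtopology) (simp add: compactin_subtopology)
  then show ?thesis
    by (rule compactin_imp_closedin[OF Hausdorff_space_realization])
qed

lemma continuous_map_Min:
  fixes f :: "'b \<Rightarrow> 'a \<Rightarrow> real"
  assumes "finite \<sigma>" "\<sigma> \<noteq> {}" "\<And>v. v \<in> \<sigma> \<Longrightarrow> continuous_map X euclideanreal (\<lambda>x. f x v)"
  shows "continuous_map X euclideanreal (\<lambda>x. Min (f x ` \<sigma>))"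
  using assms
proof (induction \<sigma> rule: finite_ne_induct)
  case (insert v \<sigma>)
  have "Min (f x ` insert v \<sigma>) = min (f x v) (Min (f x ` \<sigma>))" for x
    using insert.hyps by simp
  with insert show ?case
    by (simp add: continuous_map_real_min)
qed simp

lemma Min_coordinate_eq_0:
  assumes "finite \<sigma>" "\<sigma> \<noteq> {}" "\<And>v. 0 \<le> (x v :: real)"
  shows "Min (x ` \<sigma>) = 0 \<longleftrightarrow> (\<exists>v\<in>\<sigma>. x v = 0)"
proof
  assume "Min (x ` \<sigma>) = 0"
  then show "\<exists>v\<in>\<sigma>. x v = 0"
    using Min_in[of "x ` \<sigma>"] assms by auto
next
  assume "\<exists>v\<in>\<sigma>. x v = 0"
  then have "0 \<in> x ` \<sigma>"
    by force
  then show "Min (x ` \<sigma>) = 0"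
    using assms by (intro Min_eqI) auto
qed

lemma Min_coordinate_nonneg:
  assumes "finite \<sigma>" "\<sigma> \<noteq> {}" "\<And>v. 0 \<le> (x v :: real)"
  shows "0 \<le> Min (x ` \<sigma>)"
  using assms by auto

subsection \<open>Elementary collapses as homotopies\<close>

lemma continuous_map_fst_unit_interval:
  "continuous_map (prod_topology (top_of_set {0..1::real}) X) euclideanreal fst"
  by (rule continuous_map_into_fulltopology[OF continuous_map_fst])

lemma continuous_map_of_snd':
  "continuous_map X Y f \<Longrightarrow> continuous_map (prod_topology T X) Y (\<lambda>p. f (snd p))"
  using continuous_map_compose[OF continuous_map_snd, of X Y f T] by (simp add: o_def)

text \<open>\<open>H\<close> moves mass from \<sigma> to \<open>v\<close>: with \<open>m\<close> the
  smallest coordinate on \<sigma>, the amount \<open>t * m x\<close> is taken from each vertex of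
  \<sigma> and the total is given to \<open>v\<close>. At time 1 some vertex of \<sigma> has
  coordinate 0, while points of the smaller complex have \<open>m x = 0\<close> and never move, so
  this is a deformation retraction.\<close>

lemma homotopy_equivalent_space_elementary_collapse:
  assumes K: "simplicial_complex K" and \<sigma>: "\<sigma> \<in> K" "\<sigma> \<noteq> {}" "v \<notin> \<sigma>" "insert v \<sigma> \<in> K"
    and free: "\<And>\<rho>. \<rho> \<in> K \<Longrightarrow> \<sigma> \<subseteq> \<rho> \<Longrightarrow> \<rho> = \<sigma> \<or> \<rho> = insert v \<sigma>"
  shows "simplicial_complex (K - {\<sigma>, insert v \<sigma>})"
    and "realization K homotopy_equivalent_space realization (K - {\<sigma>, insert v \<sigma>})"
proof -
  let ?K' = "K - {\<sigma>, insert v \<sigma>}"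
  show K': "simplicial_complex ?K'"
  proof -
    have "\<rho> \<in> ?K'" if "\<tau> \<in> ?K'" "\<rho> \<subseteq> \<tau>" for \<rho> \<tau>
    proof -
      have "\<rho> \<in> K"
        using that K by (auto simp: simplicial_complex_def)
      moreover have "\<not> \<sigma> \<subseteq> \<rho>"
        using that free[of \<tau>] by blast
      ultimately show ?thesis
        by blast
    qed
    then show ?thesis
      using K unfolding simplicial_complex_def by blast
  qed
  have fin: "finite \<sigma>"
    using K \<sigma>(1) by (simp add: simplicial_complex_def)
  define m where "m x = Min (x ` \<sigma>)" for x :: "'a \<Rightarrow> real"
  define H where "H t x u = x u + t * m x * (if u = v then real (card \<sigma>) else if u \<in> \<sigma> then -1 else 0)"
    for t x u
  have m_le: "m x \<le> x u" if "u \<in> \<sigma>" for x u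
    unfolding m_def using that fin by simp
  have m0: "m x = 0 \<longleftrightarrow> (\<exists>u\<in>\<sigma>. x u = 0)" if "x \<in> topspace (realization K)" for x
    unfolding m_def using that fin \<sigma>(2) by (intro Min_coordinate_eq_0) (auto simp: topspace_realization)
  have H0: "H t x = x" if "m x = 0" for t x
    using that by (simp add: H_def fun_eq_iff)
  \<comment> \<open>Freeness enters here: where \<open>m\<close> is nonzero the support contains
    \<sigma>, so all motion stays within the simplex \<open>insert v \<sigma>\<close>.\<close>
  have simplex: "x \<in> closed_simplex (insert v \<sigma>)" if x: "x \<in> topspace (realization K)" "m x \<noteq> 0" for x
  proof -
    have "\<sigma> \<subseteq> {u. x u \<noteq> 0}"
      using m0[OF x(1)] x(2) by blast
    then have "{u. x u \<noteq> 0} = \<sigma> \<or> {u. x u \<noteq> 0} = insert v \<sigma>"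
      using free realization_supportD(1)[OF x(1)] by blast
    moreover have "closed_simplex \<sigma> \<subseteq> closed_simplex (insert v \<sigma>)"
      using fin \<sigma>(3) by (auto simp: closed_simplex_def)
    ultimately show ?thesis
      using realization_supportD(2)[OF x(1)] by auto
  qed
  have H_simplex: "H t x \<in> closed_simplex (insert v \<sigma>)"
    if x: "x \<in> topspace (realization K)" "m x \<noteq> 0" and t: "t \<in> {0..1}" for t x
  proof -
    have xs: "x \<in> closed_simplex (insert v \<sigma>)"
      using simplex x by blast
    have mpos: "m x \<ge> 0"
      unfolding m_def using fin \<sigma>(2) x(1) by (intro Min_coordinate_nonneg) (auto simp: topspace_realization)
    have "sum (H t x) \<sigma> = sum x \<sigma> - t * m x * card \<sigma>"
    proof -
      have "sum (H t x) \<sigma> = (\<Sum>u\<in>\<sigma>. x u - t * m x)"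
        using \<sigma>(3) by (intro sum.cong) (auto simp: H_def)
      then show ?thesis
        by (simp add: sum_subtractf)
    qed
    moreover have "H t x v = x v + t * m x * card \<sigma>"
      by (simp add: H_def)
    ultimately have "sum (H t x) (insert v \<sigma>) = 1"
      using xs fin \<sigma>(3) by (simp add: closed_simplex_def)
    moreover have "0 \<le> H t x u" for u
    proof -
      have "t * m x \<le> x u" if "u \<in> \<sigma>"
        using mult_right_mono[of t 1 "m x"] t mpos m_le[OF that, of x] by simp
      moreover have "0 \<le> x u" "0 \<le> t * m x * real (card \<sigma>)"
        using xs t mpos by (auto simp: closed_simplex_def)
      ultimately show ?thesis
        by (auto simp: H_def)
    qed
    ultimately show ?thesis
      using xs by (simp add: closed_simplex_def H_def)
  qed
  have H_mem: "H t x \<in> topspace (realization K)"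
    if x: "x \<in> topspace (realization K)" and t: "t \<in> {0..1}" for t x
    using H0 x H_simplex[OF x _ t] closed_simplex_subset_realization[OF K \<sigma>(4)] by (cases "m x = 0") auto
  have r_mem: "H 1 x \<in> topspace (realization ?K')" if x: "x \<in> topspace (realization K)" for x
  proof (cases "m x = 0")
    case True
    then have "\<not> \<sigma> \<subseteq> {u. x u \<noteq> 0}"
      using m0[OF x] by blast
    then have "{u. x u \<noteq> 0} \<in> ?K'"
      using realization_supportD(1)[OF x] by auto
    then show ?thesis
      using x H0[OF True] by (simp add: topspace_realization)
  next
    case False
    have "m x \<in> x ` \<sigma>"
      unfolding m_def using fin \<sigma>(2) by (intro Min_in) auto
    then obtain u where u: "u \<in> \<sigma>" "x u = m x"
      by (metis imageE)
    have Hu: "H 1 x u = 0"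
      using u \<sigma>(3) by (auto simp: H_def)
    have Hs: "H 1 x \<in> closed_simplex (insert v \<sigma>)"
      using H_simplex[OF x False] by simp
    have "H 1 x \<in> closed_simplex (insert v \<sigma> - {u})"
    proof (rule closed_simplex_face[OF Hs])
      show "{w. H 1 x w \<noteq> 0} \<subseteq> insert v \<sigma> - {u}"
        using Hs Hu by (auto simp: closed_simplex_def)
    qed (use fin in auto)
    moreover have "insert v \<sigma> - {u} \<in> ?K'"
      using K \<sigma>(3,4) u(1) by (auto simp: simplicial_complex_def)
    ultimately show ?thesis
      using closed_simplex_subset_realization[OF K'] by blast
  qed
  have r_id: "H 1 x = x" if "x \<in> topspace (realization ?K')" for x
  proof -
    have x: "x \<in> topspace (realization K)" and supp: "{u. x u \<noteq> 0} \<in> ?K'"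
      using that by (auto simp: topspace_realization)
    then have "\<not> \<sigma> \<subseteq> {u. x u \<noteq> 0}"
      using free by blast
    then show ?thesis
      using m0[OF x] H0 by blast
  qed
  have cm: "continuous_map (realization K) euclideanreal m"
    unfolding m_def using fin \<sigma>(2) by (intro continuous_map_Min continuous_map_realization_coordinate)
  have "homotopic_with (\<lambda>x. True) (realization K) (realization K) id (H 1)"
    unfolding homotopic_with_def
  proof (intro exI[of _ "\<lambda>p. H (fst p) (snd p)"] conjI allI ballI)
    show "continuous_map (prod_topology (top_of_set {0..1}) (realization K)) (realization K)
        (\<lambda>p. H (fst p) (snd p))"
      unfolding continuous_map_into_realization
    proof (intro conjI allI)
      show "continuous_map (prod_topology (top_of_set {0..1}) (realization K)) euclideanreal
          (\<lambda>p. H (fst p) (snd p) u)" for u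
        unfolding H_def
        by (intro continuous_map_add continuous_map_real_mult continuous_map_fst_unit_interval
            continuous_map_of_snd' cm continuous_map_realization_coordinate) simp
    qed (use H_mem in auto)
  qed (auto simp: H_def)
  moreover have "retraction_maps (realization K) (realization ?K') (H 1) id"
    unfolding retraction_maps_def
  proof (intro conjI ballI)
    show "continuous_map (realization K) (realization ?K') (H 1)"
      unfolding continuous_map_into_realization
    proof (intro conjI allI)
      show "continuous_map (realization K) euclideanreal (\<lambda>x. H 1 x u)" for u
        unfolding H_def
        by (intro continuous_map_add continuous_map_real_mult cm
            continuous_map_realization_coordinate) simp_all
    qed (use r_mem in auto)
    show "continuous_map (realization ?K') (realization K) id"
      unfolding continuous_map_into_realization
      by (auto simp: continuous_map_realization_coordinate) (auto simp: topspace_realization)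
  qed (simp add: r_id)
  ultimately show "realization K homotopy_equivalent_space realization ?K'"
    by (metis deformation_retract_imp_homotopy_equivalent_space homotopic_with_symD)
qed

text \<open>Pairs with nonempty \<sigma> give homotopy equivalences. If the empty face is free with
  partner \<open>{v}\<close>, there are no further faces, and the realization is a point.\<close>

lemma contractible_space_realization:
  assumes "collapsible K" "simplicial_complex K"
  shows "contractible_space (realization K)"
  using assms
proof (induction K rule: collapsible.induct)
  case empty
  then show ?case
    by (intro contractible_space_subset_singleton[of _ undefined]) (simp add: topspace_realization)
next
  case (step \<sigma> K v)
  show ?case
  proof (cases "\<sigma> = {}")
    case True
    have "topspace (realization K) \<subseteq> {\<lambda>u. if u = v then 1 else 0}"
    proof
      fix x assume x: "x \<in> topspace (realization K)"
      then have "{u. x u \<noteq> 0} = {} \<or> {u. x u \<noteq> 0} = {v}" "(\<Sum>u | x u \<noteq> 0. x u) = 1"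
        using step.hyps(4)[of "{u. x u \<noteq> 0}"] True by (simp_all add: topspace_realization)
      then have supp: "{u. x u \<noteq> 0} = {v}" and "x v = 1"
        by auto
      moreover have "x u = 0" if "u \<noteq> v" for u
        using supp that by blast
      ultimately show "x \<in> {\<lambda>u. if u = v then 1 else 0}"
        by (auto simp: fun_eq_iff)
    qed
    then show ?thesis
      by (rule contractible_space_subset_singleton)
  next
    case False
    show ?thesis
      using homotopy_equivalent_space_elementary_collapse[OF step.prems step.hyps(1) False step.hyps(2-4)]
        step.IH homotopy_equivalent_space_contractibility by blast
  qed
qed

text \<open>The empty space counts as contractible, so contractibility does not supply a point. The
  first pair of the collapse does: its larger member has a vertex.\<close>

lemma topspace_realization_collapsible_nonempty:
  assumes "collapsible K" "simplicial_complex K" "K \<noteq> {}"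
  shows "topspace (realization K) \<noteq> {}"
proof -
  obtain \<sigma> v where "insert v \<sigma> \<in> K"
    using assms(1,3) by (cases rule: collapsible.cases) auto
  then have "{v} \<in> K"
    using assms(2) by (auto simp: simplicial_complex_def)
  then have "(\<lambda>u. if u = v then 1 else 0) \<in> topspace (realization K)"
    using closed_simplex_subset_realization[OF assms(2), of "{v}"] by (auto simp: closed_simplex_def)
  then show ?thesis
    by blast
qed

subsection \<open>The sphere as a quotient of a simplex\<close>

lemma nsphere_eq_basepoint_iff:
  assumes "s \<in> topspace (nsphere d)"
  shows "s = sphere_basepoint \<longleftrightarrow> s 0 = 1"
proof
  assume s0: "s 0 = 1"
  have "(\<Sum>i\<le>d. (s i)\<^sup>2) = 1" "\<And>i. d < i \<Longrightarrow> s i = 0"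
    using assms by (auto simp: nsphere)
  then have "(\<Sum>i<d. (s (Suc i))\<^sup>2) = 0"
    using s0 by (simp add: sum.atMost_shift)
  then have "s (Suc i) = 0" if "i < d" for i
    using that by (simp add: sum_nonneg_eq_0_iff)
  then have "s i = 0" if "i \<noteq> 0" for i
    using that \<open>\<And>i. d < i \<Longrightarrow> s i = 0\<close> by (cases i; cases "i \<le> d") auto
  then show "s = sphere_basepoint"
    using s0 by (auto simp: sphere_basepoint_def fun_eq_iff)
qed (simp add: sphere_basepoint_def)

text \<open>These are the properties of the quotient of a simplex by its boundary. Surjectivity is
  asked only away from the basepoint: for \<open>d = 0\<close> the boundary is empty and the
  basepoint is not attained.\<close>

definition sphere_quotient :: "nat \<Rightarrow> 'a set \<Rightarrow> (('a \<Rightarrow> real) \<Rightarrow> nat \<Rightarrow> real) \<Rightarrow> bool" where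
  "sphere_quotient d \<sigma> \<phi> \<longleftrightarrow>
    continuous_map (subtopology (powertop_real UNIV) (closed_simplex \<sigma>)) (nsphere d) \<phi> \<and>
    (\<forall>x\<in>closed_simplex \<sigma>. \<phi> x = sphere_basepoint \<longleftrightarrow> (\<exists>v\<in>\<sigma>. x v = 0)) \<and>
    (\<forall>x\<in>closed_simplex \<sigma>. \<forall>y\<in>closed_simplex \<sigma>. \<phi> x = \<phi> y \<longrightarrow> \<phi> x \<noteq> sphere_basepoint \<longrightarrow> x = y) \<and>
    (\<forall>s\<in>topspace (nsphere d). s \<noteq> sphere_basepoint \<longrightarrow> (\<exists>x\<in>closed_simplex \<sigma>. \<phi> x = s))"

text \<open>Dividing the differences \<open>x\<^sub>i - x\<^sub>0\<close> of barycentric coordinates by the smallest coordinate \<open>m\<close>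
  maps the open simplex bijectively onto \<open>\<real>\<^sup>d\<close>. Followed by inverse stereographic projection this
  is a quotient of quadratic forms, which extends by the value \<open>sphere_basepoint\<close> to the boundary \<open>m = 0\<close>.\<close>

lemma sphere_quotient_exists:
  assumes fin: "finite \<sigma>" and card: "card \<sigma> = Suc d"
  shows "\<exists>\<phi>. sphere_quotient d \<sigma> \<phi>"
proof -
  obtain e where e: "bij_betw e {..d} \<sigma>"
    using ex_bij_betw_nat_finite[OF fin] card by (auto simp: atLeast0LessThan lessThan_Suc_atMost)
  have e_mem: "e i \<in> \<sigma>" if "i \<le> d" for i
    using e that by (auto simp: bij_betw_def)
  have e_img: "\<sigma> = e ` {..d}"
    using e by (auto simp: bij_betw_def)
  have ne: "\<sigma> \<noteq> {}"
    using card by auto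
  have sum_e: "sum x \<sigma> = (\<Sum>i\<le>d. x (e i))" for x :: "'a \<Rightarrow> real"
    using sum.reindex_bij_betw[OF e, of x] by simp
  define m where "m x = Min (x ` \<sigma>)" for x :: "'a \<Rightarrow> real"
  define z where "z x i = x (e i) - x (e 0)" for x :: "'a \<Rightarrow> real" and i
  define N where "N x = (\<Sum>i\<le>d. (z x i)\<^sup>2)" for x
  define D where "D x = N x + (m x)\<^sup>2" for x
  \<comment> \<open>With \<open>y = z / m\<close>, inverse stereographic projection from the
    basepoint is \<open>(|y|^2 - 1, 2 y) / (|y|^2 + 1)\<close>; expanding the fractions by
    \<open>m^2\<close> gives these formulas. As \<open>z x 0 = 0\<close>, index 0 is free for the
    coordinate along the axis.\<close>
  define \<phi> where "\<phi> x i = (if i = 0 then (N x - (m x)\<^sup>2) / D x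
      else if i \<le> d then 2 * m x * z x i / D x else 0)" for x i
  have z0: "z x 0 = 0" for x
    by (simp add: z_def)
  have N_nonneg: "N x \<ge> 0" for x
    by (simp add: N_def sum_nonneg)
  have m0: "m x = 0 \<longleftrightarrow> (\<exists>v\<in>\<sigma>. x v = 0)" if "x \<in> closed_simplex \<sigma>" for x
    unfolding m_def using that fin ne by (intro Min_coordinate_eq_0) (auto simp: closed_simplex_def)
  have m_nonneg: "m x \<ge> 0" if "x \<in> closed_simplex \<sigma>" for x
    unfolding m_def using that fin ne by (intro Min_coordinate_nonneg) (auto simp: closed_simplex_def)
  have m_le: "m x \<le> x (e i)" if "i \<le> d" for x i
    unfolding m_def using fin e_mem[OF that] by simp
  have m_attained: "\<exists>i\<le>d. x (e i) = m x" for x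
  proof -
    have "m x \<in> x ` \<sigma>"
      unfolding m_def using fin ne by (intro Min_in) auto
    then show ?thesis
      unfolding e_img by fastforce
  qed
  have D_pos: "D x > 0" if x: "x \<in> closed_simplex \<sigma>" for x
  proof (rule ccontr)
    assume "\<not> D x > 0"
    moreover have "D x \<ge> 0"
      using N_nonneg[of x] by (simp add: D_def)
    ultimately have "N x + (m x)\<^sup>2 = 0"
      by (simp add: D_def)
    then have "N x = 0" "m x = 0"
      using N_nonneg[of x] by (simp_all add: add_nonneg_eq_0_iff)
    then have "z x i = 0" if "i \<le> d" for i
      using that by (simp add: N_def sum_nonneg_eq_0_iff)
    then have const: "x (e i) = x (e 0)" if "i \<le> d" for i
      using that by (metis eq_iff_diff_eq_0 z_def)
    moreover obtain j where "j \<le> d" "x (e j) = 0"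
      using m_attained[of x] \<open>m x = 0\<close> by auto
    ultimately have "x (e i) = 0" if "i \<le> d" for i
      using that by metis
    then show False
      using x sum_e[of x] by (simp add: closed_simplex_def)
  qed
  have \<phi>_sphere: "\<phi> x \<in> topspace (nsphere d)" if x: "x \<in> closed_simplex \<sigma>" for x
  proof -
    have "(\<Sum>i\<le>d. (\<phi> x i)\<^sup>2) = ((N x - (m x)\<^sup>2) / D x)\<^sup>2 + (\<Sum>i<d. (2 * m x * z x (Suc i) / D x)\<^sup>2)"
      by (simp add: sum.atMost_shift \<phi>_def)
    also have "(\<Sum>i<d. (2 * m x * z x (Suc i) / D x)\<^sup>2) = (2 * m x / D x)\<^sup>2 * (\<Sum>i<d. (z x (Suc i))\<^sup>2)"
      by (simp add: sum_distrib_left power_mult_distrib power_divide)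
    also have "(\<Sum>i<d. (z x (Suc i))\<^sup>2) = N x"
      by (simp add: N_def sum.atMost_shift z0)
    also have "((N x - (m x)\<^sup>2) / D x)\<^sup>2 + (2 * m x / D x)\<^sup>2 * N x
        = ((N x - (m x)\<^sup>2)\<^sup>2 + 4 * (m x)\<^sup>2 * N x) / (D x)\<^sup>2"
      by (simp add: power_divide power_mult_distrib add_divide_distrib)
    also have "(N x - (m x)\<^sup>2)\<^sup>2 + 4 * (m x)\<^sup>2 * N x = (D x)\<^sup>2"
      by (simp add: D_def power2_eq_square algebra_simps)
    finally show ?thesis
      using D_pos[OF x] by (simp add: nsphere \<phi>_def)
  qed
  have \<phi>_0: "1 - \<phi> x 0 = 2 * (m x)\<^sup>2 / D x" if "x \<in> closed_simplex \<sigma>" for x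
  proof -
    have "1 - \<phi> x 0 = (D x - (N x - (m x)\<^sup>2)) / D x"
      using D_pos[OF that] by (simp add: \<phi>_def diff_divide_distrib)
    then show ?thesis
      by (simp add: D_def)
  qed
  have base: "\<phi> x = sphere_basepoint \<longleftrightarrow> m x = 0" if x: "x \<in> closed_simplex \<sigma>" for x
  proof -
    have "\<phi> x = sphere_basepoint \<longleftrightarrow> 1 - \<phi> x 0 = 0"
      using nsphere_eq_basepoint_iff[OF \<phi>_sphere[OF x]] by auto
    then show ?thesis
      using \<phi>_0[OF x] D_pos[OF x] by simp
  qed
  have "sphere_quotient d \<sigma> \<phi>"
    unfolding sphere_quotient_def
  proof (intro conjI ballI impI)
    show "continuous_map (subtopology (powertop_real UNIV) (closed_simplex \<sigma>)) (nsphere d) \<phi>"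
      (is "continuous_map ?T _ _")
    proof -
      have c: "continuous_map ?T euclideanreal (\<lambda>x. x v)" for v
        by (intro continuous_map_from_subtopology continuous_map_product_coordinates) simp
      have cm: "continuous_map ?T euclideanreal m"
        unfolding m_def using fin ne c by (intro continuous_map_Min)
      have cz: "continuous_map ?T euclideanreal (\<lambda>x. z x i)" for i
        unfolding z_def by (intro continuous_map_diff c)
      have cN: "continuous_map ?T euclideanreal N"
        unfolding N_def by (intro continuous_map_sum continuous_map_real_pow cz) simp
      have cD: "continuous_map ?T euclideanreal D"
        unfolding D_def by (intro continuous_map_add cN continuous_map_real_pow cm)
      have D0: "D x \<noteq> 0" if "x \<in> topspace ?T" for x
        using that D_pos[of x] by auto
      have "continuous_map ?T euclideanreal (\<lambda>x. (N x - (m x)\<^sup>2) / D x)"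
        by (intro continuous_map_real_divide continuous_map_diff continuous_map_real_pow cN cD cm D0)
      moreover have "continuous_map ?T euclideanreal (\<lambda>x. 2 * m x * z x i / D x)" for i
        by (intro continuous_map_real_divide continuous_map_real_mult cz cD cm D0) simp_all
      ultimately have "continuous_map ?T euclideanreal (\<lambda>x. \<phi> x i)" for i
        unfolding \<phi>_def by (cases "i = 0"; cases "i \<le> d") simp_all
      then show ?thesis
        using \<phi>_sphere
        by (auto simp: nsphere continuous_map_in_subtopology continuous_map_componentwise_UNIV)
    qed
    show "\<phi> x = sphere_basepoint \<longleftrightarrow> (\<exists>v\<in>\<sigma>. x v = 0)" if "x \<in> closed_simplex \<sigma>" for x
      using base[OF that] m0[OF that] by simp
  next
    fix x y assume x: "x \<in> closed_simplex \<sigma>" and y: "y \<in> closed_simplex \<sigma>"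
      and eq: "\<phi> x = \<phi> y" and nb: "\<phi> x \<noteq> sphere_basepoint"
    have mx: "m x > 0" and my: "m y > 0"
      using base[OF x] base[OF y] eq nb m_nonneg[OF x] m_nonneg[OF y] by auto
    \<comment> \<open>Stereographic projection recovers the scaled differences from the image
      point.\<close>
    have quot: "\<phi> w i / (1 - \<phi> w 0) = z w i / m w"
      if "w \<in> closed_simplex \<sigma>" "m w > 0" "i \<noteq> 0" "i \<le> d" for w i
    proof -
      have "\<phi> w i / (1 - \<phi> w 0) = (2 * m w * z w i / D w) / (2 * (m w)\<^sup>2 / D w)"
        using \<phi>_0[OF that(1)] that(3,4) by (simp add: \<phi>_def)
      then show ?thesis
        using D_pos[OF that(1)] that(2) by (simp add: field_simps power2_eq_square)
    qed
    have z_eq: "z x i / m x = z y i / m y" if "i \<le> d" for i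
      using quot[OF x mx _ that] quot[OF y my _ that] eq z0 by (cases "i = 0") auto
    \<comment> \<open>The coordinates of \<open>x\<close> and \<open>y\<close>, each divided by
      their minimum, differ by a constant \<open>c\<close>. Both families have minimum 1, so
      \<open>c\<close> is 0, and equal coordinate sums then exclude a scalar factor.\<close>
    define c where "c = y (e 0) / m y - x (e 0) / m x"
    have shift: "y (e i) / m y = x (e i) / m x + c" if "i \<le> d" for i
      using z_eq[OF that] by (simp add: z_def c_def diff_divide_distrib)
    have ge1: "1 \<le> w (e i) / m w" if "i \<le> d" "m w > 0" for w i
      using m_le[OF that(1), of w] that(2) by simp
    obtain i where i: "i \<le> d" "x (e i) = m x"
      using m_attained by blast
    then have "c \<ge> 0"
      using shift[OF i(1)] ge1[OF i(1) my] mx by simp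
    moreover obtain i' where i': "i' \<le> d" "y (e i') = m y"
      using m_attained by blast
    then have "c \<le> 0"
      using shift[OF i'(1)] ge1[OF i'(1) mx] my by simp
    ultimately have scale: "y (e i) = x (e i) * (m y / m x)" if "i \<le> d" for i
      using shift[OF that] my mx by (simp add: field_simps)
    have "sum y \<sigma> = sum x \<sigma> * (m y / m x)"
      unfolding sum_e sum_distrib_right using scale by (intro sum.cong) auto
    then have "m y / m x = 1"
      using x y by (simp add: closed_simplex_def)
    then have "y v = x v" if "v \<in> \<sigma>" for v
      using scale that e_img by auto
    moreover have "y v = x v" if "v \<notin> \<sigma>" for v
      using that x y by (simp add: closed_simplex_def)
    ultimately show "x = y"
      by (metis ext)
  next
    fix s assume s: "s \<in> topspace (nsphere d)" "s \<noteq> sphere_basepoint"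
    have s_sum: "(s 0)\<^sup>2 + (\<Sum>i<d. (s (Suc i))\<^sup>2) = 1" and s_out: "\<And>i. d < i \<Longrightarrow> s i = 0"
      using s(1) by (auto simp: nsphere sum.atMost_shift)
    have "(s 0)\<^sup>2 \<le> 1"
      using s_sum sum_nonneg[of "{..<d}" "\<lambda>i. (s (Suc i))\<^sup>2"] by simp
    then have s1: "s 0 < 1"
      using nsphere_eq_basepoint_iff[OF s(1)] s(2) by (simp add: abs_square_le_1 abs_le_iff)
    \<comment> \<open>The preimage is built backwards: \<open>u\<close> holds the scaled differences
      obtained by stereographic projection, \<open>w\<close> shifts them to minimum 1, and division
      by \<open>W\<close> normalizes the sum, so that the smallest coordinate becomes
      \<open>1 / W\<close>.\<close>
    define u where "u i = (if i = 0 then 0 else s i / (1 - s 0))" for i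
    define M where "M = Min (u ` {..d})"
    define w where "w i = 1 + u i - M" for i
    define W where "W = (\<Sum>i\<le>d. w i)"
    define x where "x v = (if v \<in> \<sigma> then w (inv_into {..d} e v) / W else 0)" for v
    have inv: "inv_into {..d} e (e i) = i" if "i \<le> d" for i
      using e that by (intro inv_into_f_f) (auto simp: bij_betw_def)
    have xe: "x (e i) = w i / W" if "i \<le> d" for i
      using that e_mem inv by (simp add: x_def)
    have w1: "1 \<le> w i" if "i \<le> d" for i
    proof -
      have "M \<le> u i"
        unfolding M_def using that by (intro Min_le) auto
      then show ?thesis
        by (simp add: w_def)
    qed
    have W: "W > 0"
      unfolding W_def using w1 by (intro sum_pos) force+
    have x_nonneg: "0 \<le> x v" for v
    proof (cases "v \<in> \<sigma>")
      case True
      then obtain i where "i \<le> d" "v = e i"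
        using e_img by auto
      then show ?thesis
        using xe W w1 by force
    qed (simp add: x_def)
    have "sum x \<sigma> = 1"
      unfolding sum_e using W by (simp add: xe W_def flip: sum_divide_distrib)
    with x_nonneg have x: "x \<in> closed_simplex \<sigma>"
      by (simp add: closed_simplex_def x_def)
    have "M \<in> u ` {..d}"
      unfolding M_def by (intro Min_in) auto
    then obtain i where i: "i \<le> d" "w i = 1"
      unfolding w_def by auto
    have mx: "m x = 1 / W"
      unfolding m_def
    proof (rule Min_eqI)
      show "1 / W \<in> x ` \<sigma>"
        using i xe e_mem by (metis image_eqI)
      show "1 / W \<le> y" if "y \<in> x ` \<sigma>" for y
        using that w1 W e_img xe by (auto simp: divide_right_mono)
    qed (use fin in simp)
    have zx: "z x i = u i / W" if "i \<le> d" for i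
    proof -
      have "z x i = (w i - w 0) / W"
        using that by (simp add: z_def xe diff_divide_distrib)
      then show ?thesis
        by (simp add: w_def u_def)
    qed
    define U where "U = (\<Sum>i\<le>d. (u i)\<^sup>2)"
    have Nx: "N x = U / W\<^sup>2"
      by (simp add: N_def zx U_def power_divide sum_divide_distrib)
    have "U = (\<Sum>i<d. (s (Suc i))\<^sup>2) / (1 - s 0)\<^sup>2"
      by (simp add: U_def sum.atMost_shift u_def power_divide sum_divide_distrib)
    also have "(\<Sum>i<d. (s (Suc i))\<^sup>2) = (1 + s 0) * (1 - s 0)"
      using s_sum by (simp add: power2_eq_square algebra_simps)
    finally have U: "U = (1 + s 0) / (1 - s 0)"
      using s1 by (simp add: power2_eq_square)
    then have U1: "U + 1 = 2 / (1 - s 0)"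
      using s1 by (simp add: field_simps)
    have Dx: "D x = (U + 1) / W\<^sup>2"
      by (simp add: D_def Nx mx power_divide add_divide_distrib)
    have "\<phi> x i = s i" for i
    proof -
      consider "i = 0" | "i \<noteq> 0" "i \<le> d" | "i > d" by linarith
      then show ?thesis
      proof cases
        case 1
        have "1 - \<phi> x 0 = (2 * (1 / W\<^sup>2)) / ((U + 1) / W\<^sup>2)"
          by (simp only: \<phi>_0[OF x] Dx mx power_divide power_one)
        also have "\<dots> = 1 - s 0"
          unfolding U1 using W s1 by (simp add: field_simps)
        finally show ?thesis
          using 1 by simp
      next
        case 2
        then have "\<phi> x i = 2 * (1 / W) * (u i / W) / ((U + 1) / W\<^sup>2)"
          by (simp add: \<phi>_def Dx mx zx)
        also have "\<dots> = u i * (1 - s 0)"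
          unfolding U1 using W s1 by (simp add: field_simps power2_eq_square)
        also have "\<dots> = s i"
          using 2 s1 by (simp add: u_def)
        finally show ?thesis .
      next
        case 3
        then show ?thesis
          by (simp add: \<phi>_def s_out)
      qed
    qed
    then show "\<exists>x\<in>closed_simplex \<sigma>. \<phi> x = s"
      using x by blast
  qed
  then show ?thesis
    by (rule exI[of _ \<phi>])
qed

subsection \<open>Extending the contraction over the top cells\<close>

text \<open>By \<open>dim\<close> the cells in \<open>S\<close> are maximal faces. Hence
  \<open>K - S\<close> is again a complex, and an interior point of one cell lies in no other cell
  of \<open>S\<close>.\<close>

locale top_cells =
  fixes K S :: "'a set set" and d :: nat
  assumes complex: "simplicial_complex K" and nonempty: "K \<noteq> {}"
    and S: "S \<subseteq> K" "\<And>\<sigma>. \<sigma> \<in> S \<Longrightarrow> card \<sigma> = Suc d"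
    and dim: "\<And>\<sigma>. \<sigma> \<in> K \<Longrightarrow> card \<sigma> \<le> Suc d"
begin

lemma finite_S: "finite S"
  using S(1) complex by (auto simp: simplicial_complex_def intro: finite_subset)

lemma finite_cell: "\<sigma> \<in> K \<Longrightarrow> finite \<sigma>"
  using complex by (auto simp: simplicial_complex_def)

lemma cell_ne: "\<sigma> \<in> S \<Longrightarrow> \<sigma> \<noteq> {}"
  using S(2) by fastforce

lemma cell_maximal: "\<tau> \<in> S \<Longrightarrow> \<sigma> \<in> K \<Longrightarrow> \<tau> \<subseteq> \<sigma> \<Longrightarrow> \<tau> = \<sigma>"
  using card_seteq[of \<sigma> \<tau>] finite_cell S(2) dim by metis

lemma complex_minus: "simplicial_complex (K - S)"
  unfolding simplicial_complex_def
proof (intro conjI ballI allI impI)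
  show "\<rho> \<in> K - S" if "\<sigma> \<in> K - S" "\<rho> \<subseteq> \<sigma>" for \<sigma> \<rho>
    using that cell_maximal[of \<rho> \<sigma>] complex by (auto simp: simplicial_complex_def)
qed (use complex in \<open>auto simp: simplicial_complex_def\<close>)

lemma minus_nonempty: "K - S \<noteq> {}"
proof -
  have "{} \<in> K"
    using complex nonempty by (auto simp: simplicial_complex_def)
  then show ?thesis
    using cell_ne by blast
qed

lemma realization_minus_subset: "topspace (realization (K - S)) \<subseteq> topspace (realization K)"
  by (auto simp: topspace_realization)

text \<open>For a cell \<tau> in \<open>S\<close> this is positive exactly in the interior of
  \<tau>, so at each point of the realization at most one cell has nonzero depth.\<close>

definition depth :: "'a set \<Rightarrow> ('a \<Rightarrow> real) \<Rightarrow> real" where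
  "depth \<tau> x = Min (x ` \<tau>)"

lemma depth_eq_0:
  assumes "\<tau> \<in> S" "x \<in> topspace (realization K)"
  shows "depth \<tau> x = 0 \<longleftrightarrow> (\<exists>v\<in>\<tau>. x v = 0)"
  unfolding depth_def
  using assms finite_cell cell_ne S(1)
  by (intro Min_coordinate_eq_0) (auto simp: topspace_realization)

lemma depth_nonneg:
  assumes "\<tau> \<in> S" "x \<in> topspace (realization K)"
  shows "depth \<tau> x \<ge> 0"
  unfolding depth_def
  using assms finite_cell cell_ne S(1)
  by (intro Min_coordinate_nonneg) (auto simp: topspace_realization)

lemma depth_le: "\<tau> \<in> S \<Longrightarrow> v \<in> \<tau> \<Longrightarrow> depth \<tau> x \<le> x v"
  unfolding depth_def using finite_cell S(1) by (intro Min_le) auto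

lemma depth_attained:
  assumes "\<tau> \<in> S"
  obtains v where "v \<in> \<tau>" "x v = depth \<tau> x"
proof -
  have "depth \<tau> x \<in> x ` \<tau>"
    unfolding depth_def using assms finite_cell cell_ne S(1) by (intro Min_in) auto
  then show thesis
    using that by (metis imageE)
qed

lemma depth_nonzero:
  assumes "\<tau> \<in> S" "x \<in> topspace (realization K)" "depth \<tau> x \<noteq> 0"
  shows "{v. x v \<noteq> 0} = \<tau>"
proof -
  have "\<tau> \<subseteq> {v. x v \<noteq> 0}"
    using assms depth_eq_0 by blast
  then show ?thesis
    using cell_maximal[OF assms(1) realization_supportD(1)[OF assms(2)]] by simp
qed

lemma realization_minus_iff:
  assumes "x \<in> topspace (realization K)"
  shows "x \<in> topspace (realization (K - S)) \<longleftrightarrow> (\<forall>\<tau>\<in>S. depth \<tau> x = 0)"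
proof -
  have "x \<in> topspace (realization (K - S)) \<longleftrightarrow> {v. x v \<noteq> 0} \<notin> S"
    using assms by (auto simp: topspace_realization)
  also have "\<dots> \<longleftrightarrow> (\<forall>\<tau>\<in>S. depth \<tau> x = 0)"
  proof
    assume "{v. x v \<noteq> 0} \<notin> S"
    then show "\<forall>\<tau>\<in>S. depth \<tau> x = 0"
      using depth_nonzero[OF _ assms] by metis
  next
    assume "\<forall>\<tau>\<in>S. depth \<tau> x = 0"
    then show "{v. x v \<noteq> 0} \<notin> S"
      using depth_eq_0[OF _ assms] by blast
  qed
  finally show ?thesis .
qed

text \<open>\<open>(level, push)\<close> retracts \<open>[0,1] \<times> |K|\<close> onto \<open>{0} \<times> |K| \<union> [0,1] \<times> |K - S|\<close>: inside a top cell it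
  projects radially away from the barycentre at height 2.\<close>

definition cut :: "'a set \<Rightarrow> real \<times> ('a \<Rightarrow> real) \<Rightarrow> real" where
  "cut \<tau> p = min (depth \<tau> (snd p)) (fst p / (2 * Suc d))"

text \<open>Summing over all of \<open>S\<close> gives one formula that is continuous on the whole
  cylinder, although at each point at most one summand is nonzero.\<close>

definition push :: "real \<times> ('a \<Rightarrow> real) \<Rightarrow> 'a \<Rightarrow> real" where
  "push p v = (snd p v - (\<Sum>\<tau>\<in>S. if v \<in> \<tau> then cut \<tau> p else 0)) / (1 - (\<Sum>\<tau>\<in>S. Suc d * cut \<tau> p))"

text \<open>Where the ray leaves through the side, its exact height is this value divided by the
  positive number \<open>1 - Suc d * depth \<tau> x\<close>. Without the divisor the level vanishes
  at the same points and keeps its values at time 0 and on \<open>K - S\<close>.\<close>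

definition level :: "real \<times> ('a \<Rightarrow> real) \<Rightarrow> real" where
  "level p = max 0 (fst p - 2 * Suc d * (\<Sum>\<tau>\<in>S. depth \<tau> (snd p)))"

lemma push_minus:
  assumes "t \<in> {0..1}" "x \<in> topspace (realization (K - S))"
  shows "push (t, x) = x" "level (t, x) = t"
proof -
  have "\<forall>\<tau>\<in>S. depth \<tau> x = 0"
    using assms realization_minus_iff realization_minus_subset by blast
  then have "depth \<tau> x = 0" "cut \<tau> (t, x) = 0" if "\<tau> \<in> S" for \<tau>
    using that assms(1) by (auto simp: cut_def)
  then show "push (t, x) = x" "level (t, x) = t"
    using assms(1) by (auto simp: push_def level_def fun_eq_iff intro!: sum.neutral)
qed

text \<open>Only \<tau> has nonzero depth at \<open>x\<close>, so each sum has a single term. The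
  bound 1/2, due to the height 2 of the projection centre, keeps the denominator of
  \<open>push\<close> positive.\<close>

lemma push_cell:
  fixes c :: real
  assumes t: "t \<in> {0..1}" and x: "x \<in> topspace (realization K)" and \<tau>: "{v. x v \<noteq> 0} = \<tau>" "\<tau> \<in> S"
    and c_def: "c = min (depth \<tau> x) (t / (2 * Suc d))"
  shows "push (t, x) v = (x v - (if v \<in> \<tau> then c else 0)) / (1 - Suc d * c)"
    and "(\<Sum>\<tau>\<in>S. Suc d * cut \<tau> (t, x)) = Suc d * c"
    and "level (t, x) = max 0 (t - 2 * Suc d * depth \<tau> x)"
    and "0 \<le> c" "Suc d * c \<le> 1 / 2"
proof -
  have other: "depth \<rho> x = 0" if "\<rho> \<in> S" "\<rho> \<noteq> \<tau>" for \<rho>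
    using depth_nonzero[OF that(1) x] that(2) \<tau>(1) by metis
  have depth: "depth \<rho> x = (if \<rho> = \<tau> then depth \<tau> x else 0)" if "\<rho> \<in> S" for \<rho>
    using other[OF that] by simp
  have cut: "cut \<rho> (t, x) = (if \<rho> = \<tau> then c else 0)" if "\<rho> \<in> S" for \<rho>
    using other[OF that] t by (auto simp: cut_def c_def)
  have "(\<Sum>\<rho>\<in>S. if v \<in> \<rho> then cut \<rho> (t, x) else 0) = (\<Sum>\<rho>\<in>S. if \<rho> = \<tau> then if v \<in> \<tau> then c else 0 else 0)"
    by (intro sum.cong) (auto simp: cut)
  then have 1: "(\<Sum>\<rho>\<in>S. if v \<in> \<rho> then cut \<rho> (t, x) else 0) = (if v \<in> \<tau> then c else 0)"
    using finite_S \<tau>(2) by simp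
  have "(\<Sum>\<rho>\<in>S. Suc d * cut \<rho> (t, x)) = (\<Sum>\<rho>\<in>S. if \<rho> = \<tau> then Suc d * c else 0)"
    by (intro sum.cong) (auto simp: cut)
  then show 2: "(\<Sum>\<rho>\<in>S. Suc d * cut \<rho> (t, x)) = Suc d * c"
    using finite_S \<tau>(2) by simp
  show "push (t, x) v = (x v - (if v \<in> \<tau> then c else 0)) / (1 - Suc d * c)"
    unfolding push_def 1 2 by simp
  have "(\<Sum>\<rho>\<in>S. depth \<rho> x) = (\<Sum>\<rho>\<in>S. if \<rho> = \<tau> then depth \<tau> x else 0)"
    by (intro sum.cong refl depth)
  then have "(\<Sum>\<rho>\<in>S. depth \<rho> x) = depth \<tau> x"
    using finite_S \<tau>(2) by simp
  then show "level (t, x) = max 0 (t - 2 * Suc d * depth \<tau> x)"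
    by (simp add: level_def)
  show "0 \<le> c"
    using depth_nonneg[OF \<tau>(2) x] t by (simp add: c_def)
  have "Suc d * c \<le> Suc d * (t / (2 * Suc d))"
    unfolding c_def by (intro mult_left_mono) auto
  also have "\<dots> = t / 2"
    by (simp add: field_simps)
  finally show "Suc d * c \<le> 1 / 2"
    using t by simp
qed

lemma support_cases:
  assumes "x \<in> topspace (realization K)"
  obtains "x \<in> topspace (realization (K - S))" | "{v. x v \<noteq> 0} \<in> S"
  using assms by (cases "{v. x v \<noteq> 0} \<in> S") (auto simp: topspace_realization)

lemma push_denominator:
  assumes "t \<in> {0..1}" "x \<in> topspace (realization K)"
  shows "1 - (\<Sum>\<tau>\<in>S. Suc d * cut \<tau> (t, x)) \<noteq> 0"
  using assms(2)
proof (cases rule: support_cases)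
  case 1
  then have "\<forall>\<tau>\<in>S. depth \<tau> x = 0"
    using realization_minus_iff assms by blast
  then have "(\<Sum>\<tau>\<in>S. Suc d * cut \<tau> (t, x)) = 0"
    using assms(1) by (intro sum.neutral) (auto simp: cut_def)
  then show ?thesis
    by simp
next
  case 2
  then show ?thesis
    using push_cell(2,5)[OF assms refl 2 refl] by simp
qed

lemma push_mem_cell:
  assumes t: "t \<in> {0..1}" and x: "x \<in> topspace (realization K)" and \<tau>: "{v. x v \<noteq> 0} = \<tau>" "\<tau> \<in> S"
  shows "push (t, x) \<in> closed_simplex \<tau>"
proof -
  define c where "c = min (depth \<tau> x) (t / (2 * Suc d))"
  note p = push_cell[OF t x \<tau> c_def]
  have xs: "x \<in> closed_simplex \<tau>"
    using realization_supportD(2)[OF x] \<tau>(1) by simp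
  have den: "1 - Suc d * c > 0"
    using p(5) by simp
  have c_le: "c \<le> x v" if "v \<in> \<tau>" for v
    using depth_le[OF \<tau>(2) that, of x] by (simp add: c_def)
  have "sum (push (t, x)) \<tau> = (\<Sum>v\<in>\<tau>. x v - c) / (1 - Suc d * c)"
    unfolding sum_divide_distrib by (intro sum.cong) (auto simp: p(1))
  also have "(\<Sum>v\<in>\<tau>. x v - c) = 1 - Suc d * c"
    using xs S(2)[OF \<tau>(2)] by (simp add: sum_subtractf closed_simplex_def)
  finally have "sum (push (t, x)) \<tau> = 1"
    using den by simp
  moreover have "0 \<le> push (t, x) v" for v
    using c_le[of v] xs den by (auto simp: p(1) closed_simplex_def)
  moreover have "push (t, x) v = 0" if "v \<notin> \<tau>" for v
    using that xs by (simp add: p(1) closed_simplex_def)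
  ultimately show ?thesis
    by (simp add: closed_simplex_def)
qed

lemma push_mem:
  assumes "t \<in> {0..1}" "x \<in> topspace (realization K)"
  shows "push (t, x) \<in> topspace (realization K)"
  using assms(2)
proof (cases rule: support_cases)
  case 1
  then show ?thesis
    using push_minus assms by simp
next
  case 2
  then show ?thesis
    using push_mem_cell[OF assms refl 2] closed_simplex_subset_realization[OF complex] S(1) by blast
qed

lemma level_mem:
  assumes "t \<in> {0..1}" "x \<in> topspace (realization K)"
  shows "level (t, x) \<in> {0..1}"
proof -
  have "(\<Sum>\<tau>\<in>S. depth \<tau> x) \<ge> 0"
    by (intro sum_nonneg depth_nonneg assms)
  then have "2 * real (Suc d) * (\<Sum>\<tau>\<in>S. depth \<tau> x) \<ge> 0"
    by simp
  then show ?thesis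
    using assms(1) unfolding level_def by auto
qed

text \<open>At positive level the cut is the full depth, so a smallest coordinate becomes 0: the ray
  has reached the boundary of the cell.\<close>

lemma push_level_nonzero:
  assumes t: "t \<in> {0..1}" and x: "x \<in> topspace (realization K)" and lev: "level (t, x) \<noteq> 0"
  shows "push (t, x) \<in> topspace (realization (K - S))"
  using x
proof (cases rule: support_cases)
  case 1
  then show ?thesis
    using push_minus t by simp
next
  case 2
  define \<tau> where "\<tau> = {v. x v \<noteq> 0}"
  have \<tau>: "{v. x v \<noteq> 0} = \<tau>" "\<tau> \<in> S"
    using 2 by (auto simp: \<tau>_def)
  define c where "c = min (depth \<tau> x) (t / (2 * Suc d))"
  note p = push_cell[OF t x \<tau> c_def]
  have "2 * real (Suc d) * depth \<tau> x < t"
    using lev p(3) by (auto simp: max_def split: if_splits)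
  then have "depth \<tau> x < t / (2 * real (Suc d))"
    by (simp add: field_simps)
  then have c: "c = depth \<tau> x"
    by (simp add: c_def)
  obtain u where u: "u \<in> \<tau>" "x u = depth \<tau> x"
    using depth_attained[OF \<tau>(2)] by metis
  then have "push (t, x) u = 0"
    by (simp add: p(1) c)
  then have "depth \<tau> (push (t, x)) = 0"
    using depth_eq_0[OF \<tau>(2) push_mem[OF t x]] u(1) by blast
  moreover have "depth \<rho> (push (t, x)) = 0" if "\<rho> \<in> S" "\<rho> \<noteq> \<tau>" for \<rho>
  proof -
    have "\<not> \<rho> \<subseteq> \<tau>"
      using cell_maximal[OF that(1)] \<tau>(2) S(1) that(2) by blast
    then show ?thesis
      using push_mem_cell[OF t x \<tau>] depth_eq_0[OF that(1) push_mem[OF t x]]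
      by (auto simp: closed_simplex_def)
  qed
  ultimately show ?thesis
    using realization_minus_iff[OF push_mem[OF t x]] by blast
qed

lemma push_0:
  assumes "x \<in> topspace (realization K)"
  shows "push (0, x) = x" "level (0, x) = 0"
proof -
  have "cut \<tau> (0, x) = 0" if "\<tau> \<in> S" for \<tau>
    using depth_nonneg[OF that assms] by (simp add: cut_def)
  then show "push (0, x) = x"
    by (auto simp: push_def fun_eq_iff intro!: sum.neutral)
  have "(\<Sum>\<tau>\<in>S. depth \<tau> x) \<ge> 0"
    by (intro sum_nonneg depth_nonneg assms)
  then show "level (0, x) = 0"
    by (simp add: level_def)
qed

section \<open>Continuity of the retraction and the extended contraction\<close>

lemma continuous_map_depth: "\<tau> \<in> S \<Longrightarrow> continuous_map (realization K) euclideanreal (depth \<tau>)"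
  unfolding depth_def using finite_cell cell_ne S(1)
  by (intro continuous_map_Min continuous_map_realization_coordinate) auto

abbreviation cylinder :: "(real \<times> ('a \<Rightarrow> real)) topology" where
  "cylinder \<equiv> prod_topology (top_of_set {0..1}) (realization K)"

lemma continuous_map_level: "continuous_map cylinder euclideanreal level"
  unfolding level_def
  by (intro continuous_map_real_max continuous_map_diff continuous_map_real_mult continuous_map_sum
      continuous_map_fst_unit_interval continuous_map_of_snd' continuous_map_depth finite_S) simp_all

lemma continuous_map_push: "continuous_map cylinder (realization K) push"
  unfolding continuous_map_into_realization
proof (intro conjI allI)
  have cut: "continuous_map cylinder euclideanreal (cut \<tau>)" if "\<tau> \<in> S" for \<tau>
    unfolding cut_def using that
    by (intro continuous_map_real_min continuous_map_real_divide
      continuous_map_fst_unit_interval continuous_map_of_snd' continuous_map_depth) simp_all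
  fix v
  have "continuous_map cylinder euclideanreal (\<lambda>p. if v \<in> \<tau> then cut \<tau> p else 0)" if "\<tau> \<in> S" for \<tau>
    using cut[OF that] by (cases "v \<in> \<tau>") simp_all
  moreover have "continuous_map cylinder euclideanreal (\<lambda>p. Suc d * cut \<tau> p)" if "\<tau> \<in> S" for \<tau>
    using cut[OF that] by (intro continuous_map_real_mult) simp_all
  ultimately show "continuous_map cylinder euclideanreal (\<lambda>p. push p v)"
    unfolding push_def using push_denominator
    by (intro continuous_map_real_divide continuous_map_diff continuous_map_sum finite_S
        continuous_map_of_snd' continuous_map_realization_coordinate) auto
qed (use push_mem in auto)

text \<open>The retraction comes first, then the contraction of the realization of
  \<open>K - S\<close> runs for time \<open>level\<close>. Where the level is 0 the contraction is
  the identity, so the two formulas for \<open>h\<close> agree and can be pasted.\<close>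

lemma extend_contraction:
  assumes "contractible_space (realization (K - S))"
  obtains h a where "continuous_map cylinder (realization K) h"
    "\<And>x. x \<in> topspace (realization K) \<Longrightarrow> h (0, x) = x"
    "\<And>t x. t \<in> {0..1} \<Longrightarrow> x \<in> topspace (realization (K - S)) \<Longrightarrow> h (t, x) \<in> topspace (realization (K - S))"
    "\<And>x. x \<in> topspace (realization (K - S)) \<Longrightarrow> h (1, x) = a"
proof -
  let ?Y = "realization (K - S)"
  let ?IY = "prod_topology (top_of_set {0..1::real}) ?Y"
  obtain a H where H: "continuous_map ?IY ?Y H" "\<And>x. H (0, x) = x" "\<And>x. H (1, x) = a"
    using assms unfolding contractible_space_def homotopic_with_def by auto
  define h where "h p = (if level p = 0 then push p else H (level p, push p))" for p
  define C where "C b = (if b then {p \<in> topspace cylinder. level p \<in> {0}}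
    else {p \<in> topspace cylinder. push p \<in> topspace ?Y})" for b
  have "continuous_map cylinder (realization K) h"
  proof (rule pasting_lemma_closed[of "{True, False}" cylinder C _ "\<lambda>b. if b then push else (\<lambda>p. H (level p, push p))"])
    show "closedin cylinder (C b)" for b
    proof (cases b)
      case True
      then show ?thesis
        using closedin_continuous_map_preimage[OF continuous_map_level, of "{0}"] by (simp add: C_def)
    next
      case False
      have "closedin (realization K) (topspace ?Y)"
        by (intro closedin_realization compactin_realization complex_minus realization_minus_subset)
      then show ?thesis
        using closedin_continuous_map_preimage[OF continuous_map_push] False by (simp add: C_def)
    qed
    show "continuous_map (subtopology cylinder (C b)) (realization K)
      (if b then push else (\<lambda>p. H (level p, push p)))" for b
    proof (cases b)
      case True
      then show ?thesis
        using continuous_map_push by (simp add: continuous_map_from_subtopology)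
    next
      case False
      let ?T = "subtopology cylinder (C False)"
      have "continuous_map ?T (top_of_set {0..1}) level"
        using continuous_map_level level_mem
        by (intro continuous_map_into_subtopology continuous_map_from_subtopology) auto
      moreover have "continuous_map ?T (realization K) push"
        by (intro continuous_map_from_subtopology continuous_map_push)
      then have "continuous_map ?T ?Y push"
        unfolding continuous_map_into_realization by (auto simp: C_def)
      ultimately have "continuous_map ?T ?IY (\<lambda>p. (level p, push p))"
        by (intro continuous_map_pairedI)
      then have "continuous_map ?T ?Y (\<lambda>p. H (level p, push p))"
        using continuous_map_compose[OF _ H(1)] by (force simp: o_def)
      then have "continuous_map ?T (realization K) (\<lambda>p. H (level p, push p))"
        unfolding continuous_map_into_realization using realization_minus_subset by blast
      then show ?thesis
        using False by simp
    qed
    show "(if b then push else (\<lambda>p. H (level p, push p))) p = (if b' then push else (\<lambda>p. H (level p, push p))) p"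
      if "p \<in> topspace cylinder \<inter> C b \<inter> C b'" for b b' p
      using that H(2) by (cases b; cases b') (auto simp: C_def)
    show "\<exists>b. b \<in> {True, False} \<and> p \<in> C b \<and> h p = (if b then push else (\<lambda>p. H (level p, push p))) p"
      if p: "p \<in> topspace cylinder" for p
    proof (cases "level p = 0")
      case True
      then show ?thesis
        using p by (intro exI[of _ True]) (auto simp: C_def h_def)
    next
      case False
      then have "push p \<in> topspace ?Y"
        using p push_level_nonzero[of "fst p" "snd p"] by auto
      then show ?thesis
        using p False by (intro exI[of _ False]) (auto simp: C_def h_def)
    qed
  qed simp
  moreover have "h (0, x) = x" if "x \<in> topspace (realization K)" for x
    using push_0[OF that] by (simp add: h_def)
  moreover have hY: "h (t, x) = H (t, x)" if "t \<in> {0..1}" "x \<in> topspace ?Y" for t x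
    using push_minus[OF that] H(2) by (auto simp: h_def)
  moreover have "H (t, x) \<in> topspace ?Y" if "t \<in> {0..1}" "x \<in> topspace ?Y" for t x
    using H(1) that by (auto simp: continuous_map_def)
  ultimately show thesis
    using that[of h a] H(3) by simp
qed

text \<open>The map \<open>f\<close> sends the realization of \<open>K - S\<close> to the wedge
  point and each cell onto its sphere, and it is injective elsewhere. The extended contraction is
  the homotopy required by \<open>homotopy_equivalent_space_quotient\<close>.\<close>

theorem homotopy_equivalent_space_wedge_of_spheres:
  assumes "collapsible (K - S)" and k: "card S = k"
  shows "realization K homotopy_equivalent_space
    wedge {..<k} (\<lambda>_. nsphere d) (\<lambda>_. sphere_basepoint)"
proof -
  let ?Y = "topspace (realization (K - S))"
  let ?p = "\<lambda>_::nat. sphere_basepoint"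
  let ?W = "wedge {..<k} (\<lambda>_. nsphere d) ?p"
  obtain h a where h: "continuous_map cylinder (realization K) h"
    "\<And>x. x \<in> topspace (realization K) \<Longrightarrow> h (0, x) = x"
    "\<And>t x. t \<in> {0..1} \<Longrightarrow> x \<in> ?Y \<Longrightarrow> h (t, x) \<in> ?Y"
    "\<And>x. x \<in> ?Y \<Longrightarrow> h (1, x) = a"
    using extend_contraction contractible_space_realization[OF assms(1) complex_minus] by metis
  obtain b where b: "bij_betw b {..<k} S"
    using ex_bij_betw_nat_finite[OF finite_S] k by (auto simp: atLeast0LessThan)
  have bS: "b i \<in> S" if "i < k" for i
    using b that by (auto simp: bij_betw_def)
  have "\<exists>\<phi>. sphere_quotient d (b i) \<phi>" if "i < k" for i
    using bS[OF that] S finite_cell by (intro sphere_quotient_exists) auto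
  then obtain \<phi> where quot: "\<And>i. i < k \<Longrightarrow> sphere_quotient d (b i) (\<phi> i)"
    by metis
  have \<phi>:
    "\<And>i. i < k \<Longrightarrow> continuous_map (subtopology (powertop_real UNIV) (closed_simplex (b i))) (nsphere d) (\<phi> i)"
    "\<And>i x. i < k \<Longrightarrow> x \<in> closed_simplex (b i) \<Longrightarrow> \<phi> i x = sphere_basepoint \<longleftrightarrow> (\<exists>v\<in>b i. x v = 0)"
    "\<And>i x y. i < k \<Longrightarrow> x \<in> closed_simplex (b i) \<Longrightarrow> y \<in> closed_simplex (b i) \<Longrightarrow> \<phi> i x = \<phi> i y \<Longrightarrow>
      \<phi> i x \<noteq> sphere_basepoint \<Longrightarrow> x = y"
    "\<And>i s. i < k \<Longrightarrow> s \<in> topspace (nsphere d) \<Longrightarrow> s \<noteq> sphere_basepoint \<Longrightarrow> \<exists>x\<in>closed_simplex (b i). \<phi> i x = s"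
    using quot unfolding sphere_quotient_def by blast+
  have simplex_sub: "closed_simplex (b i) \<subseteq> topspace (realization K)" if "i < k" for i
    using closed_simplex_subset_realization[OF complex] bS[OF that] S(1) by blast
  have base_iff: "\<phi> i x = sphere_basepoint \<longleftrightarrow> depth (b i) x = 0" if "i < k" "x \<in> closed_simplex (b i)" for i x
    using \<phi>(2)[OF that] depth_eq_0[OF bS[OF that(1)]] simplex_sub[OF that(1)] that(2) by blast
  have simplex_Y: "x \<in> ?Y \<longleftrightarrow> \<phi> i x = sphere_basepoint" if "i < k" "x \<in> closed_simplex (b i)" for i x
  proof -
    have xK: "x \<in> topspace (realization K)"
      using simplex_sub that by blast
    have "depth \<tau> x = 0" if "\<tau> \<in> S" "\<tau> \<noteq> b i" for \<tau>
    proof (rule ccontr)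
      assume "depth \<tau> x \<noteq> 0"
      then have "{v. x v \<noteq> 0} = \<tau>"
        using depth_nonzero[OF that(1) xK] by blast
      then have "\<tau> \<subseteq> b i"
        using \<open>x \<in> closed_simplex (b i)\<close> by (auto simp: closed_simplex_def)
      then show False
        using cell_maximal[OF that(1), of "b i"] bS[OF \<open>i < k\<close>] S(1) that(2) by blast
    qed
    then show ?thesis
      using realization_minus_iff[OF xK] base_iff[OF that] bS[OF that(1)] by blast
  qed
  \<comment> \<open>\<open>None\<close> indexes the realization of \<open>K - S\<close> and
    \<open>Some i\<close> the closed cell \<open>b i\<close>; \<open>f\<close> is pasted from the
    pieces \<open>F\<close> over this finite closed cover.\<close>
  define C where "C = case_option ?Y (\<lambda>i. closed_simplex (b i))"
  define F where "F = case_option (\<lambda>_. None) (\<lambda>i x. wedge_proj ?p i (\<phi> i x))"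
  let ?I = "insert None (Some ` {..<k})"
  have cover: "topspace (realization K) \<subseteq> (\<Union>i\<in>?I. C i)"
  proof
    fix x assume x: "x \<in> topspace (realization K)"
    then show "x \<in> (\<Union>i\<in>?I. C i)"
    proof (cases rule: support_cases)
      case 2
      then obtain i where "i < k" "b i = {v. x v \<noteq> 0}"
        using b by (auto simp: bij_betw_def image_iff)
      then show ?thesis
        using realization_supportD(2)[OF x] by (intro UN_I[of "Some i"]) (auto simp: C_def)
    qed (auto simp: C_def)
  qed
  have F_None: "F i x = None" if "i \<in> ?I" "x \<in> C i" "x \<in> ?Y" for i x
    using that simplex_Y by (cases i) (auto simp: F_def C_def wedge_proj_def)
  have F_agree: "F i x = F j x" if hyp: "i \<in> ?I" "j \<in> ?I" "x \<in> topspace (realization K) \<inter> C i \<inter> C j" for i j x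
  proof (cases "x \<in> ?Y")
    case True
    then show ?thesis
      using F_None hyp by auto
  next
    case False
    then obtain i' j' where ij: "i = Some i'" "j = Some j'" "i' < k" "j' < k"
      "x \<in> closed_simplex (b i')" "x \<in> closed_simplex (b j')"
      using hyp by (auto simp: C_def)
    then have "depth (b i') x \<noteq> 0" "depth (b j') x \<noteq> 0"
      using False simplex_Y base_iff by metis+
    then have "b i' = b j'"
      using depth_nonzero bS ij hyp by (metis IntD1)
    then show ?thesis
      using b ij by (auto simp: bij_betw_def inj_on_def)
  qed
  \<comment> \<open>The choice of the index is harmless by \<open>F_agree\<close>: different cells
    meet only inside the realization of \<open>K - S\<close>.\<close>
  define f where "f x = F (SOME i. i \<in> ?I \<and> x \<in> C i) x" for x
  have f_some: "\<exists>i. i \<in> ?I \<and> x \<in> C i \<and> f x = F i x" if "x \<in> topspace (realization K)" for x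
  proof -
    have "\<exists>i. i \<in> ?I \<and> x \<in> C i"
      using cover that by blast
    from someI_ex[OF this] show ?thesis
      unfolding f_def by blast
  qed
  have f_eq: "f x = F i x" if "i \<in> ?I" "x \<in> topspace (realization K) \<inter> C i" for x i
    using f_some[of x] F_agree[OF that(1)] that by (metis IntD1 IntD2 IntI)
  have f: "continuous_map (realization K) ?W f"
  proof (rule pasting_lemma_closed[of ?I "realization K" C ?W F])
    show "closedin (realization K) (C i)" if "i \<in> ?I" for i
    proof (cases i)
      case None
      then show ?thesis
        unfolding C_def by (auto intro!: closedin_realization compactin_realization complex_minus realization_minus_subset)
    next
      case (Some j)
      then have "j < k"
        using that by auto
      then show ?thesis
        using Some simplex_sub[OF \<open>j < k\<close>] finite_cell bS S(1)
        by (auto simp: C_def intro!: closedin_realization compactin_closed_simplex)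
    qed
    show "continuous_map (subtopology (realization K) (C i)) ?W (F i)" if "i \<in> ?I" for i
    proof (cases i)
      case None
      then show ?thesis
        by (simp add: F_def topspace_wedge)
    next
      case (Some j)
      then have j: "j < k"
        using that by auto
      have "subtopology (realization K) (C i) = subtopology (powertop_real UNIV) (closed_simplex (b j))"
        using simplex_sub[OF j] Some
        by (subst realization_eq_subtopology) (simp add: C_def subtopology_subtopology Int_absorb1)
      moreover have "continuous_map (nsphere d) ?W (wedge_proj ?p j)"
        using continuous_map_wedge_proj[of j "{..<k}" "\<lambda>_. nsphere d"] j by simp
      ultimately show ?thesis
        using continuous_map_compose[OF \<phi>(1)[OF j]] Some by (auto simp: F_def o_def)
    qed
    show "F i x = F j x" if "i \<in> ?I" "j \<in> ?I" "x \<in> topspace (realization K) \<inter> C i \<inter> C j" for i j x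
      by (rule F_agree[OF that])
    show "\<exists>i. i \<in> ?I \<and> x \<in> C i \<and> f x = F i x" if "x \<in> topspace (realization K)" for x
      by (rule f_some[OF that])
  qed simp
  have fY: "f x = None" if "x \<in> ?Y" for x
    using f_eq[of None x] that realization_minus_subset by (auto simp: C_def F_def)
  have f_cell: "f x = wedge_proj ?p i (\<phi> i x)" if "i < k" "x \<in> closed_simplex (b i)" for i x
    using f_eq[of "Some i" x] that simplex_sub by (auto simp: C_def F_def)
  have cell_cases: "x \<in> ?Y \<or> (\<exists>i<k. x \<in> closed_simplex (b i) \<and> \<phi> i x \<noteq> sphere_basepoint \<and> f x = Some (i, \<phi> i x))"
    if x: "x \<in> topspace (realization K)" for x
  proof (cases "x \<in> ?Y")
    case False
    then obtain i where "i < k" "x \<in> closed_simplex (b i)"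
      using cover x by (auto simp: C_def)
    then show ?thesis
      using False simplex_Y f_cell by (auto simp: wedge_proj_def)
  qed simp
  show ?thesis
  proof (rule homotopy_equivalent_space_quotient[of _ _ f ?Y h a])
    show "compact_space (realization K)"
      by (rule compact_space_realization[OF complex])
    show "Hausdorff_space ?W"
    proof (rule Hausdorff_space_wedge)
      show "Hausdorff_space (nsphere d)"
        unfolding nsphere by (intro Hausdorff_space_subtopology) (auto simp: Hausdorff_space_product_topology)
    qed (rule sphere_basepoint_in_nsphere)
    show "f ` topspace (realization K) = topspace ?W"
    proof
      show "f ` topspace (realization K) \<subseteq> topspace ?W"
        using f by (auto simp: continuous_map_def)
      show "topspace ?W \<subseteq> f ` topspace (realization K)"
      proof
        fix w assume "w \<in> topspace ?W"
        then consider "w = None"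
          | i s where "i < k" "s \<in> topspace (nsphere d)" "s \<noteq> sphere_basepoint" "w = Some (i, s)"
          by (auto simp: topspace_wedge wedge_proj_def split: if_splits)
        then show "w \<in> f ` topspace (realization K)"
        proof cases
          case 1
          \<comment> \<open>Cells need not supply a point over the wedge point: there may be none,
            or they may have dimension 0 and empty boundary.\<close>
          obtain y where "y \<in> ?Y"
            using topspace_realization_collapsible_nonempty[OF assms(1) complex_minus minus_nonempty] by blast
          then show ?thesis
            using 1 fY realization_minus_subset by (metis image_eqI subsetD)
        next
          case 2
          then obtain x where x: "x \<in> closed_simplex (b i)" "\<phi> i x = s"
            using \<phi>(4) by blast
          then have "f x = w"
            using 2 f_cell by (simp add: wedge_proj_def)
          then show ?thesis
            using x(1) simplex_sub[OF 2(1)] by blast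
        qed
      qed
    qed
    show "x = y \<or> x \<in> ?Y \<and> y \<in> ?Y"
      if xy: "x \<in> topspace (realization K)" "y \<in> topspace (realization K)" "f x = f y" for x y
    proof (cases "f x = None")
      case True
      then show ?thesis
        using cell_cases[OF xy(1)] cell_cases[OF xy(2)] xy(3) by auto
    next
      case False
      then show ?thesis
        using cell_cases[OF xy(1)] cell_cases[OF xy(2)] xy(3) fY \<phi>(3) by auto
    qed
  qed (use f h fY realization_minus_subset in auto)
qed

end

text \<open>The rank bound \<open>2 * j - i - 1\<close> on chains is the size of the removed cells,
  which makes them top cells; the absolute value removes the sign \<open>(-1)^i\<close> of the
  coefficient.\<close>

theorem theorem4p6:
  fixes i j :: nat
  assumes "i \<le> j"
  shows "interval_homotopic_to_wedge_of_spheres (replicate i L1) (replicate j L3)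
           (nat \<bar>coeff (chebyshev_T (i + j)) (j - i)\<bar>) (2 * int j - int i - 2)"
proof -
  let ?K = "word_complex (lower_interval i j)"
  have count: "nat \<bar>coeff (chebyshev_T (i + j)) (j - i)\<bar> = cell_count i j"
    by (simp add: coeff_chebyshev_T_eq_cell_count[OF assms] abs_mult)
  have dim: "card F \<le> 2 * j - i - 1" if "F \<in> ?K" for F
    using card_word_chain[of F "replicate i L1" "replicate j L3"] that assms
    by (simp add: lower_interval_def subword_le_replicate_L3)
  have fin: "finite (lower_interval i j)"
    by (simp add: lower_interval_def finite_open_word_interval)
  have empty: "topspace (realization ?K) = {}" if "2 * j - i - 1 = 0"
  proof -
    have "F = {}" if "F \<in> ?K" for F
      using dim[OF that] \<open>2 * j - i - 1 = 0\<close> that by (auto simp: order_complex_def)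
    then show ?thesis
      by (fastforce simp: topspace_realization)
  qed
  have "homotopic_to_wedge_of_spheres (realization ?K) (cell_count i j) (2 * int j - int i - 2)"
  proof (cases "2 * j - i - 1 = 0")
    case True
    \<comment> \<open>Truncated subtraction merges the dimensions -2 (\<open>i = j = 0\<close>) and
      -1 (\<open>i = j = 1\<close>). In both cases the open interval is empty and the count is 1, as
      the convention for negative dimension demands.\<close>
    then have "j = 0 \<and> i = 0 \<or> j = Suc 0 \<and> i = Suc 0"
      using assms by auto
    then show ?thesis
      using empty[OF True] by (auto simp: homotopic_to_wedge_of_spheres_def)
  next
    case False
    then obtain d where d: "2 * j - i - 1 = Suc d"
      by (cases "2 * j - i - 1") auto
    then obtain m where m: "j = Suc m"
      by (cases j) auto
    have "2 * m + 1 - i = Suc d"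
      using d m by simp
    then have "collapses_off_cells (Suc d) (cell_count i j) ?K"
      using lower_interval_collapses_off_cells[of i m] assms m by simp
    then obtain S where cells: "S \<subseteq> ?K" "card S = cell_count i j" "\<forall>\<sigma>\<in>S. card \<sigma> = Suc d"
      "collapsible (?K - S)"
      unfolding collapses_off_cells_def by blast
    interpret top_cells ?K S d
    proof
      show "simplicial_complex ?K"
        using fin by (rule simplicial_complex_order_complex)
      have "{} \<in> ?K"
        by (simp add: order_complex_def)
      then show "?K \<noteq> {}"
        by blast
    qed (use cells dim d in auto)
    have "2 * int j - int i - 2 = int d"
      using d by linarith
    then show ?thesis
      using homotopy_equivalent_space_wedge_of_spheres[OF cells(4,2)]
      by (simp add: homotopic_to_wedge_of_spheres_def)
  qed
  then show ?thesis
    by (simp add: interval_homotopic_to_wedge_of_spheres_def count lower_interval_def)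
qed

end
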